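(* Every finitely generated nilpotent group $G$ of nilpotency class at most two is graph automatic.
   Context: For a finite alphabet $\Sigma$, let $\Sigma^\star$ be the set of finite strings over $\Sigma$. For strings $w_1,\dots,w_n\in\Sigma^\star$ the convolution $\otimes(w_1,\dots,w_n)$ is the string of length $\max_i|w_i|$ over the alphabet $(\Sigma\cup\{\diamond\})^n$ (with $\diamond\notin\Sigma$) whose $k$-th symbol is $(\sigma_1,\dots,\sigma_n)$, where $\sigma_i$ is the $k$-th symbol of $w_i$ if $k\le|w_i|$ and $\sigma_i=\diamond$ otherwise. A relation $R\subseteq(\Sigma^\star)^n$ is FA recognizable if $\{\otimes(w_1,\dots,w_n)\mid (w_1,\dots,w_n)\in R\}$ is a regular language (recognized by a finite automaton). Let $G$ be a group generated by a finite set $X$. Its Cayley graph $\Gamma(G,X)$ is viewed as the structure $(G;(E_x)_{x\in X})$ with $E_x=\{(g,gx)\mid g\in G\}$. The group $G$ is graph automatic with respect to $X$ if there are a finite alphabet $\Sigma$, a regular language $R\subseteq\Sigma^\star$ and a bijection $\nu:R\to G$ such that for each $x\in X$ the relation $\{(u,v)\in R^2\mid \nu(u)x=\nu(v)\}$ is FA recognizable. A finitely generated group is graph automatic if it is graph automatic with respect to some finite generating set. *)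

theory Defs
  imports "HOL-Algebra.Generated_Groups"
begin

record ('s, 'a) dfa =
  dfa_states :: "'s set"
  dfa_init :: 's
  dfa_trans :: "'s \<Rightarrow> 'a \<Rightarrow> 's"
  dfa_final :: "'s set"

definition dfa_over :: "'a set \<Rightarrow> ('s, 'a) dfa \<Rightarrow> bool" where
  "dfa_over A M \<longleftrightarrow>
     finite (dfa_states M) \<and>
     dfa_init M \<in> dfa_states M \<and>
     (\<forall>q \<in> dfa_states M. \<forall>a \<in> A. dfa_trans M q a \<in> dfa_states M) \<and>
     dfa_final M \<subseteq> dfa_states M"

definition dfa_language :: "'a set \<Rightarrow> ('s, 'a) dfa \<Rightarrow> 'a list set" where
  "dfa_language A M =
     {w \<in> lists A. foldl (dfa_trans M) (dfa_init M) w \<in> dfa_final M}"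

text \<open>Every finite state set can be renamed into the natural numbers, so restricting the
  states to type \<^typ>\<open>nat\<close> loses no languages.\<close>

definition regular_language :: "'a set \<Rightarrow> 'a list set \<Rightarrow> bool" where
  "regular_language A L \<longleftrightarrow>
     finite A \<and> (\<exists>M :: (nat, 'a) dfa. dfa_over A M \<and> L = dfa_language A M)"

text \<open>A tuple of strings is a list of strings; an \<open>n\<close>-ary relation is a set of lists of length
  \<open>n\<close>. The padding symbol is \<^term>\<open>None\<close>, and a letter of the convolution alphabet
  is a list of length \<open>n\<close> over the alphabet extended by \<^term>\<open>None\<close>. The inserted 0
  only affects the empty tuple.\<close>

definition convolution :: "'a list list \<Rightarrow> 'a option list list" where
  "convolution ws =
     map (\<lambda>k. map (\<lambda>w. if k < length w then Some (w ! k) else None) ws)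
       [0..<Max (insert 0 (length ` set ws))]"

definition convolution_alphabet :: "nat \<Rightarrow> 'a set \<Rightarrow> 'a option list set" where
  "convolution_alphabet n \<Sigma> = {\<sigma>. length \<sigma> = n \<and> set \<sigma> \<subseteq> insert None (Some ` \<Sigma>)}"

definition FA_recognizable :: "nat \<Rightarrow> 'a set \<Rightarrow> 'a list list set \<Rightarrow> bool" where
  "FA_recognizable n \<Sigma> R \<longleftrightarrow>
     R \<subseteq> {ws. length ws = n \<and> set ws \<subseteq> lists \<Sigma>} \<and>
     regular_language (convolution_alphabet n \<Sigma>) (convolution ` R)"

definition cayley_edges :: "('g, 'm) monoid_scheme \<Rightarrow> 'g \<Rightarrow> ('g \<times> 'g) set" where
  "cayley_edges G x = {(g, g \<otimes>\<^bsub>G\<^esub> x) | g. g \<in> carrier G}"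

definition finite_generating_set :: "('g, 'm) monoid_scheme \<Rightarrow> 'g set \<Rightarrow> bool" where
  "finite_generating_set G X \<longleftrightarrow>
     finite X \<and> X \<subseteq> carrier G \<and> generate G X = carrier G"

definition finitely_generated_group :: "('g, 'm) monoid_scheme \<Rightarrow> bool" where
  "finitely_generated_group G \<longleftrightarrow> group G \<and> (\<exists>X. finite_generating_set G X)"

text \<open>Every finite alphabet can be renamed into the natural numbers, so letters are taken
  from type \<^typ>\<open>nat\<close>.\<close>

definition graph_automatic_wrt :: "('g, 'm) monoid_scheme \<Rightarrow> 'g set \<Rightarrow> bool" where
  "graph_automatic_wrt G X \<longleftrightarrow>
     finite_generating_set G X \<and>
     (\<exists>(\<Sigma> :: nat set) R \<nu>.
        finite \<Sigma> \<and> regular_language \<Sigma> R \<and> bij_betw \<nu> R (carrier G) \<and>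
        (\<forall>x \<in> X. FA_recognizable 2 \<Sigma>
           {[u, v] | u v. u \<in> R \<and> v \<in> R \<and> (\<nu> u, \<nu> v) \<in> cayley_edges G x}))"

definition graph_automatic :: "('g, 'm) monoid_scheme \<Rightarrow> bool" where
  "graph_automatic G \<longleftrightarrow> finitely_generated_group G \<and> (\<exists>X. graph_automatic_wrt G X)"

definition commutator_subgroup ::
    "('g, 'm) monoid_scheme \<Rightarrow> 'g set \<Rightarrow> 'g set \<Rightarrow> 'g set" where
  "commutator_subgroup G H K =
     generate G {h \<otimes>\<^bsub>G\<^esub> k \<otimes>\<^bsub>G\<^esub> inv\<^bsub>G\<^esub> h \<otimes>\<^bsub>G\<^esub> inv\<^bsub>G\<^esub> k | h k. h \<in> H \<and> k \<in> K}"

text \<open>The series is indexed from 0, so that a group has nilpotency class at most \<open>c\<close>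
  if and only if its \<open>c\<close>-th term is trivial.\<close>

fun lower_central_series :: "('g, 'm) monoid_scheme \<Rightarrow> nat \<Rightarrow> 'g set" where
  "lower_central_series G 0 = carrier G"
| "lower_central_series G (Suc n) =
     commutator_subgroup G (lower_central_series G n) (carrier G)"

definition nilpotent_group :: "('g, 'm) monoid_scheme \<Rightarrow> bool" where
  "nilpotent_group G \<longleftrightarrow> group G \<and> (\<exists>n. lower_central_series G n = {\<one>\<^bsub>G\<^esub>})"

definition nilpotency_class :: "('g, 'm) monoid_scheme \<Rightarrow> nat" where
  "nilpotency_class G = (LEAST n. lower_central_series G n = {\<one>\<^bsub>G\<^esub>})"

end

theory Submission
  imports Defs "HOL-Library.Nat_Bijection" "HOL-Algebra.FiniteProduct"
begin

text \<open>Let \<open>Z\<close> be the derived subgroup. It is central, and it is finitely generated because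
  commutators are bilinear in class two. Choose \<open>a\<^sub>i\<close> whose images decompose the abelianization
  into cyclic groups, and \<open>c\<^sub>k\<close> decomposing \<open>Z\<close> likewise. Every element is then uniquely
  \<open>a^m c^l\<close> with the exponents of the torsion generators reduced. Right multiplication by \<open>a\<^sub>j\<close>
  increases \<open>m\<^sub>j\<close> by one, possibly with a carry, and changes \<open>l\<close> by a linear function of \<open>m\<close>, so
  each edge relation is a Boolean combination of linear congruences and equations in the exponents.
  Finite automata decide these when integers are written in base \<open>-2\<close>, least significant digit
  first: every integer has a unique such expansion, and no sign is needed.\<close>

section \<open>Languages with finitely many residuals\<close>

text \<open>Class two enters through bilinearity: moving \<open>a j\<close> left past
  \<open>a i [^] m i\<close> leaves the \<open>m i\<close>-th power of the fixed central element
  \<open>commutator (a i) (a j)\<close>, so variables are only ever multiplied by constants. From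
  class three on, corrections of higher degree in the exponents can occur, which is beyond linear
  arithmetic on words. Graph automaticity leaves the generating set free, so the given one is
  exchanged for the \<open>a i\<close> and \<open>c k\<close>. The carry is the only nonlinear
  effect. One multiplication raises one exponent by one, so at most one wrap-around happens and a
  case distinction on \<open>v j = u j + 1\<close> captures it.\<close>

definition residual :: "'a set \<Rightarrow> ('a list \<Rightarrow> bool) \<Rightarrow> 'a list \<Rightarrow> 'a list set" where
  "residual A P w = {u \<in> lists A. P (w @ u)}"

text \<open>The Myhill-Nerode criterion serves as the working notion of regularity: closure
  properties become statements about finite sets, and an automaton is built only once, in
  \<open>regular_language_residuals\<close>.\<close>

definition finite_residuals :: "'a set \<Rightarrow> ('a list \<Rightarrow> bool) \<Rightarrow> bool" where
  "finite_residuals A P \<longleftrightarrow> finite (residual A P ` lists A)"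

text \<open>\<open>g\<close> plays the state reached after \<open>w\<close>, and
  \<open>h s u\<close> says whether \<open>u\<close> is accepted from state \<open>s\<close>. The
  residual of \<open>w\<close> depends on \<open>g w\<close> alone, so there are no more residuals
  than states. No transition function has to be exhibited.\<close>

lemma finite_residualsI:
  assumes "finite (g ` lists A)"
    and "\<And>w u. w \<in> lists A \<Longrightarrow> u \<in> lists A \<Longrightarrow> P (w @ u) \<longleftrightarrow> h (g w) u"
  shows "finite_residuals A P"
proof -
  have "residual A P w = {u \<in> lists A. h (g w) u}" if "w \<in> lists A" for w
    unfolding residual_def using assms(2)[OF that] by blast
  then have "residual A P ` lists A \<subseteq> (\<lambda>s. {u \<in> lists A. h s u}) ` g ` lists A"
    by (intro image_subsetI) (simp only: image_image, rule imageI)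
  then show ?thesis
    unfolding finite_residuals_def using assms(1) by (meson finite_imageI finite_subset)
qed

text \<open>The pair of residuals is a sufficient state, as in a product automaton. Leaving
  \<open>f\<close> arbitrary covers all Boolean connectives at once.\<close>

lemma finite_residuals_binop:
  assumes "finite_residuals A P" "finite_residuals A Q"
  shows "finite_residuals A (\<lambda>w. f (P w) (Q w))"
proof (rule finite_residualsI[where g = "\<lambda>w. (residual A P w, residual A Q w)"
      and h = "\<lambda>s u. f (u \<in> fst s) (u \<in> snd s)"])
  have "(\<lambda>w. (residual A P w, residual A Q w)) ` lists A
      \<subseteq> (residual A P ` lists A) \<times> (residual A Q ` lists A)"
    by auto
  then show "finite ((\<lambda>w. (residual A P w, residual A Q w)) ` lists A)"
    using assms unfolding finite_residuals_def by (meson finite_SigmaI finite_subset)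
qed (simp add: residual_def)

lemma finite_residuals_conj:
  "finite_residuals A P \<Longrightarrow> finite_residuals A Q \<Longrightarrow> finite_residuals A (\<lambda>w. P w \<and> Q w)"
  by (rule finite_residuals_binop)

lemma finite_residuals_imp:
  "finite_residuals A P \<Longrightarrow> finite_residuals A Q \<Longrightarrow> finite_residuals A (\<lambda>w. P w \<longrightarrow> Q w)"
  by (rule finite_residuals_binop)

lemma finite_residuals_const: "finite_residuals A (\<lambda>w. c)"
  by (rule finite_residualsI[where g = "\<lambda>_. ()" and h = "\<lambda>_ _. c"]) auto

lemma finite_residuals_not:
  "finite_residuals A P \<Longrightarrow> finite_residuals A (\<lambda>w. \<not> P w)"
  by (rule finite_residuals_binop[where f = "\<lambda>p q. \<not> p"])

lemma finite_residuals_ball: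
  assumes "finite I" "\<And>i. i \<in> I \<Longrightarrow> finite_residuals A (P i)"
  shows "finite_residuals A (\<lambda>w. \<forall>i\<in>I. P i w)"
  using assms
proof (induction I rule: finite_induct)
  case empty
  show ?case by (simp add: finite_residuals_const)
next
  case (insert i I)
  then show ?case by (simp add: finite_residuals_conj)
qed

lemma finite_residuals_bex:
  assumes "finite I" "\<And>i. i \<in> I \<Longrightarrow> finite_residuals A (P i)"
  shows "finite_residuals A (\<lambda>w. \<exists>i\<in>I. P i w)"
proof -
  have "finite_residuals A (\<lambda>w. \<not> (\<forall>i\<in>I. \<not> P i w))"
    by (intro finite_residuals_not finite_residuals_ball assms)
  then show ?thesis by simp
qed

text \<open>The residuals themselves are the states: reading \<open>a\<close> passes to the
  derivative \<open>{u. a # u \<in> q}\<close>, and a state is final if it contains the empty word.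
  The injection \<open>f\<close> renames residuals to numbers, the state type that
  \<open>regular_language\<close> prescribes.\<close>

lemma regular_language_residuals:
  assumes "finite A" "finite_residuals A P"
  shows "regular_language A {w \<in> lists A. P w}"
proof -
  let ?r = "residual A P"
  let ?Q = "?r ` lists A"
  have "finite ?Q"
    using assms(2) by (simp add: finite_residuals_def)
  then obtain f :: "'a list set \<Rightarrow> nat" where f: "inj_on f ?Q"
    using finite_imp_inj_to_nat_seg by metis
  define \<delta> where "\<delta> n a = f {u. a # u \<in> inv_into ?Q f n}" for n a
  define M where "M = \<lparr>dfa_states = f ` ?Q, dfa_init = f (?r []), dfa_trans = \<delta>,
      dfa_final = f ` {q \<in> ?Q. [] \<in> q}\<rparr>"
  have step: "\<delta> (f (?r w)) a = f (?r (w @ [a]))" if "w \<in> lists A" "a \<in> A" for w a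
  proof -
    have "inv_into ?Q f (f (?r w)) = ?r w"
      using that f by (intro inv_into_f_f) auto
    moreover have "{u. a # u \<in> ?r w} = ?r (w @ [a])"
      using that by (auto simp: residual_def)
    ultimately show ?thesis by (simp add: \<delta>_def)
  qed
  have run: "foldl \<delta> (f (?r [])) w = f (?r w)" if "w \<in> lists A" for w
    using that by (induction w rule: rev_induct) (auto simp: step)
  have "dfa_over A M"
    unfolding dfa_over_def M_def using \<open>finite ?Q\<close> step by (fastforce simp: image_iff)
  moreover have "{w \<in> lists A. P w} = dfa_language A M"
  proof -
    have "P w \<longleftrightarrow> f (?r w) \<in> f ` {q \<in> ?Q. [] \<in> q}" if "w \<in> lists A" for w
    proof -
      have "f (?r w) \<in> f ` {q \<in> ?Q. [] \<in> q} \<longleftrightarrow> ?r w \<in> {q \<in> ?Q. [] \<in> q}"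
        using f that by (intro inj_on_image_mem_iff[where B = ?Q]) auto
      also have "\<dots> \<longleftrightarrow> P w"
        using that by (auto simp: residual_def)
      finally show ?thesis by simp
    qed
    then show ?thesis
      unfolding dfa_language_def M_def by (simp add: run cong: conj_cong)
  qed
  ultimately show ?thesis
    unfolding regular_language_def using assms(1) by blast
qed

lemma finite_residuals_last:
  assumes "finite A"
  shows "finite_residuals A (\<lambda>w. w = [] \<or> P (last w))"
proof (rule finite_residualsI[where g = "\<lambda>w. if w = [] then None else Some (last w)"
      and h = "\<lambda>s u. if u = [] then s = None \<or> P (the s) else P (last u)"])
  have "(if w = [] then None else Some (last w)) \<in> insert None (Some ` A)" if "w \<in> lists A" for w
    using that by (cases w rule: rev_cases) auto
  then have "(\<lambda>w. if w = [] then None else Some (last w)) ` lists A \<subseteq> insert None (Some ` A)"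
    by (rule image_subsetI)
  then show "finite ((\<lambda>w. if w = [] then None else Some (last w)) ` lists A)"
    using assms by (meson finite.insertI finite_imageI finite_subset)
qed auto

text \<open>When a word is split, only the junction is new, so the last letter read and one bit for
  the past suffice.\<close>

lemma finite_residuals_successively:
  assumes "finite A"
  shows "finite_residuals A (successively P)"
proof (rule finite_residualsI[
      where g = "\<lambda>w. (successively P w, if w = [] then None else Some (last w))"
      and h = "\<lambda>s u. fst s \<and> successively P u \<and> (snd s = None \<or> u = [] \<or> P (the (snd s)) (hd u))"])
  let ?g = "\<lambda>w. (successively P w, if w = [] then None else Some (last w))"
  have "?g w \<in> UNIV \<times> insert None (Some ` A)" if "w \<in> lists A" for w
    using that by (cases w rule: rev_cases) auto
  then have "?g ` lists A \<subseteq> UNIV \<times> insert None (Some ` A)"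
    by (rule image_subsetI)
  then show "finite (?g ` lists A)"
    by (rule finite_subset) (use assms in simp)
qed (auto simp: successively_append_iff)

section \<open>Linear congruences in base \<open>-2\<close>\<close>

fun negabinary :: "int list \<Rightarrow> int" where
  "negabinary [] = 0"
| "negabinary (x # xs) = x - 2 * negabinary xs"

lemma negabinary_append:
  "negabinary (xs @ ys) = negabinary xs + (-2) ^ length xs * negabinary ys"
  by (induction xs) (auto simp: algebra_simps)

text \<open>The geometric sum \<open>1 + 2 + ... + 2 ^ (length xs - 1)\<close>, scaled by the bound
  on the digits.\<close>

lemma negabinary_bound:
  assumes "\<forall>x \<in> set xs. \<bar>x\<bar> \<le> H"
  shows "\<bar>negabinary xs\<bar> \<le> H * (2 ^ length xs - 1)"
  using assms
proof (induction xs)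
  case (Cons x xs)
  then have "\<bar>x\<bar> \<le> H" "\<bar>negabinary xs\<bar> \<le> H * (2 ^ length xs - 1)"
    by simp_all
  then have "\<bar>x - 2 * negabinary xs\<bar> \<le> H + 2 * (H * (2 ^ length xs - 1))"
    by linarith
  then show ?case
    by (simp add: algebra_simps)
qed simp

text \<open>Digits may be arbitrary integers, so sums and multiples are formed letter by letter
  without propagating carries. Carries appear only in the states of
  \<open>finite_residuals_dvd\<close>.\<close>

definition linear_functional :: "'a set \<Rightarrow> ('a list \<Rightarrow> int) \<Rightarrow> bool" where
  "linear_functional A f \<longleftrightarrow> (\<exists>h. \<forall>w \<in> lists A. f w = negabinary (map h w))"

lemma linear_functional_negabinary: "linear_functional A (\<lambda>w. negabinary (map h w))"
  unfolding linear_functional_def by (intro exI[of _ h]) simp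

lemma linear_functional_add:
  assumes "linear_functional A f" "linear_functional A g"
  shows "linear_functional A (\<lambda>w. f w + g w)"
proof -
  obtain h k where "\<forall>w \<in> lists A. f w = negabinary (map h w)" "\<forall>w \<in> lists A. g w = negabinary (map k w)"
    using assms by (auto simp: linear_functional_def)
  moreover have "negabinary (map h w) + negabinary (map k w) = negabinary (map (\<lambda>a. h a + k a) w)" for w
    by (induction w) auto
  ultimately show ?thesis
    unfolding linear_functional_def by (intro exI[of _ "\<lambda>a. h a + k a"]) auto
qed

lemma linear_functional_mult:
  assumes "linear_functional A f"
  shows "linear_functional A (\<lambda>w. f w * c)"
proof -
  obtain h where "\<forall>w \<in> lists A. f w = negabinary (map h w)"
    using assms by (auto simp: linear_functional_def)
  moreover have "negabinary (map h w) * c = negabinary (map (\<lambda>a. h a * c) w)" for w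
    by (induction w) (auto simp: algebra_simps)
  ultimately show ?thesis
    unfolding linear_functional_def by (intro exI[of _ "\<lambda>a. h a * c"]) auto
qed

lemma linear_functional_diff:
  assumes "linear_functional A f" "linear_functional A g"
  shows "linear_functional A (\<lambda>w. f w - g w)"
  using linear_functional_add[OF assms(1) linear_functional_mult[OF assms(2), of "-1"]] by simp

lemma linear_functional_sum:
  assumes "\<And>i. i \<in> I \<Longrightarrow> linear_functional A (f i)"
  shows "linear_functional A (\<lambda>w. \<Sum>i\<in>I. f i w)"
proof (cases "finite I")
  case True
  then show ?thesis using assms
  proof (induction I rule: finite_induct)
    case empty
    show ?case using linear_functional_mult[OF linear_functional_negabinary, of _ _ 0] by (simp only: mult_zero_right sum.empty)
  next
    case (insert i I)
    then show ?case by (simp add: linear_functional_add)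
  qed
next
  case False
  then show ?thesis
    using linear_functional_mult[OF linear_functional_negabinary, of _ _ 0] by (simp only: mult_zero_right sum.infinite not_False_eq_True)
qed

lemma mod_linear:
  fixes x p y b e :: int
  shows "(x + p * y + b) mod e = (x mod e + p mod e * y + b) mod e"
proof -
  have "p * y mod e = p mod e * y mod e"
    by (simp only: mod_mult_left_eq)
  then show ?thesis
    by (intro mod_add_cong) auto
qed

text \<open>For \<open>e = 0\<close> the state after reading \<open>w\<close> is the exact quotient of \<open>f w + b\<close> by
  \<open>(-2) ^ length w\<close>; it stays bounded because \<open>\<bar>f w\<bar>\<close> is \<open>O(2 ^ length w)\<close>.\<close>

lemma finite_residuals_dvd:
  fixes e b :: int
  assumes "finite A" "linear_functional A f"
  shows "finite_residuals A (\<lambda>w. e dvd f w + b)"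
proof -
  obtain h where h: "\<And>w. w \<in> lists A \<Longrightarrow> f w = negabinary (map h w)"
    using assms by (auto simp: linear_functional_def)
  have app: "f (w @ u) = f w + (-2) ^ length w * f u" if "w \<in> lists A" "u \<in> lists A" for w u
    using that by (simp add: h negabinary_append)
  show ?thesis
  proof (cases "e = 0")
    case False
    \<comment> \<open>A nonzero modulus needs only two residues: that of the value read so far and
      that of the current place value. As \<open>e\<close> may be negative, both are placed in a
      symmetric interval.\<close>
    show ?thesis
    proof (rule finite_residualsI[where g = "\<lambda>w. (f w mod e, (-2) ^ length w mod e)"
          and h = "\<lambda>s u. e dvd fst s + snd s * f u + b"])
      let ?g = "\<lambda>w. (f w mod e, (-2) ^ length w mod e)"
      have "x mod e \<in> {-\<bar>e\<bar>..\<bar>e\<bar>}" for x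
        using False abs_mod_less[of e x] by auto
      then have "?g ` lists A \<subseteq> {-\<bar>e\<bar>..\<bar>e\<bar>} \<times> {-\<bar>e\<bar>..\<bar>e\<bar>}"
        by blast
      then show "finite (?g ` lists A)"
        by (rule finite_subset) auto
      show "e dvd f (w @ u) + b \<longleftrightarrow> e dvd fst (?g w) + snd (?g w) * f u + b"
        if "w \<in> lists A" "u \<in> lists A" for w u
      proof -
        have "(f w + (-2) ^ length w * f u + b) mod e = (f w mod e + (-2) ^ length w mod e * f u + b) mod e"
          by (rule mod_linear)
        then show ?thesis
          by (simp only: dvd_eq_mod_eq_0 app[OF that] fst_conv snd_conv)
      qed
    qed
  next
    case True
    \<comment> \<open>Bound on the digits; the inserted \<open>0\<close> covers the empty alphabet
      and gives \<open>H \<ge> 0\<close>.\<close>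
    define H where "H = Max (insert 0 ((\<lambda>a. \<bar>h a\<bar>) ` A))"
    have H: "\<bar>h a\<bar> \<le> H" if "a \<in> A" for a
      using assms(1) that by (auto simp: H_def)
    have H0: "H \<ge> 0"
      using assms(1) by (auto simp: H_def)
    \<comment> \<open>\<open>None\<close> is the dead state: every continuation adds a multiple of
      \<open>(-2) ^ length w\<close>, so a value not divisible by it can never become
      \<open>0\<close>.\<close>
    define g where "g w = (if (-2) ^ length w dvd f w + b then Some ((f w + b) div (-2) ^ length w) else None)" for w
    have "g w \<in> insert None (Some ` {-(H + \<bar>b\<bar>)..H + \<bar>b\<bar>})" if "w \<in> lists A" for w
    proof (cases "(-2) ^ length w dvd f w + b")
      case True
      then obtain t where t: "f w + b = (-2) ^ length w * t" by (auto simp: dvd_def)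
      have "\<bar>f w\<bar> \<le> H * (2 ^ length w - 1)"
        using that H negabinary_bound[of "map h w" H] by (auto simp: h in_lists_conv_set)
      also have "\<dots> \<le> H * 2 ^ length w"
        using H0 by (simp add: algebra_simps)
      moreover have t': "\<bar>f w + b\<bar> = 2 ^ length w * \<bar>t\<bar>"
        unfolding t abs_mult power_abs by simp
      ultimately have "\<bar>f w + b\<bar> \<le> H * 2 ^ length w + \<bar>b\<bar> * 1"
        by linarith
      also have "\<dots> \<le> H * 2 ^ length w + \<bar>b\<bar> * 2 ^ length w"
        by (intro add_left_mono mult_left_mono) auto
      finally have "2 ^ length w * \<bar>t\<bar> \<le> 2 ^ length w * (H + \<bar>b\<bar>)"
        by (simp add: t' distrib_left distrib_right mult.commute)
      then have "\<bar>t\<bar> \<le> H + \<bar>b\<bar>" by simp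
      moreover have "g w = Some t"
        unfolding g_def t by simp
      ultimately show ?thesis
        unfolding insert_iff by (intro disjI2 image_eqI[of _ _ t]) auto
    next
      case False
      then have "g w = None" by (simp only: g_def if_False)
      then show ?thesis by simp
    qed
    then have sub: "g ` lists A \<subseteq> insert None (Some ` {-(H + \<bar>b\<bar>)..H + \<bar>b\<bar>})"
      by (rule image_subsetI)
    show ?thesis
    proof (rule finite_residualsI[where g = g
          and h = "\<lambda>s u. case s of None \<Rightarrow> False | Some t \<Rightarrow> t + f u = 0"])
      show "finite (g ` lists A)"
        using sub by (rule finite_subset) auto
      show "e dvd f (w @ u) + b \<longleftrightarrow> (case g w of None \<Rightarrow> False | Some t \<Rightarrow> t + f u = 0)"
        if "w \<in> lists A" "u \<in> lists A" for w u
      proof -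
        have "f (w @ u) + b = (f w + b) + (-2) ^ length w * f u"
          using app[OF that] by simp
        also have "\<dots> = 0 \<longleftrightarrow> (case g w of None \<Rightarrow> False | Some t \<Rightarrow> t + f u = 0)"
        proof (cases "(-2) ^ length w dvd f w + b")
          case True
          then obtain t where t: "f w + b = (-2) ^ length w * t" by (auto simp: dvd_def)
          have "g w = Some t"
            unfolding g_def t by simp
          moreover have "(f w + b) + (-2) ^ length w * f u = (-2) ^ length w * (t + f u)"
            unfolding t by (simp only: distrib_left)
          ultimately show ?thesis by simp
        next
          case False
          have "(f w + b) + (-2) ^ length w * f u \<noteq> 0"
          proof
            assume "(f w + b) + (-2) ^ length w * f u = 0"
            then have "f w + b = (-2) ^ length w * (- f u)" by linarith
            then show False using False dvdI by blast
          qed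
          moreover have "g w = None" using False by (simp only: g_def if_False)
          ultimately show ?thesis by (simp only: option.case)
        qed
        finally show ?thesis unfolding True dvd_0_left_iff .
      qed
    qed
  qed
qed

section \<open>Words as integer vectors\<close>

text \<open>A letter codes the set of coordinates whose current digit is \<open>1\<close>. One word
  thus carries the expansions of all coordinates in parallel, over letters of the required type
  \<open>nat\<close>.\<close>

definition digit :: "nat \<Rightarrow> nat \<Rightarrow> int" where
  "digit i a = of_bool (i \<in> set_decode a)"

definition coordinates :: "nat list \<Rightarrow> nat \<Rightarrow> int" where
  "coordinates w i = negabinary (map (digit i) w)"

definition letters :: "nat \<Rightarrow> nat set" where
  "letters N = set_encode ` Pow {..<N}"

text \<open>The last letter is the most significant one, and \<open>0\<close> codes the empty set of
  coordinates. Excluding it at the end removes the only ambiguity of the expansion.\<close>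

definition canonical :: "nat list \<Rightarrow> bool" where
  "canonical w \<longleftrightarrow> w = [] \<or> last w \<noteq> 0"

lemma canonical_Cons: "canonical (a # w) \<longleftrightarrow> canonical w \<and> (w = [] \<longrightarrow> a \<noteq> 0)"
  by (auto simp: canonical_def)

lemma canonical_Nil [simp]: "canonical []"
  by (simp add: canonical_def)

lemma finite_letters: "finite (letters N)"
  by (simp add: letters_def)

lemma digit_zero [simp]: "digit i 0 = 0"
  by (simp add: digit_def)

lemma digit_inject: "(\<forall>i. digit i a = digit i b) \<longleftrightarrow> a = b"
proof
  assume "\<forall>i. digit i a = digit i b"
  then have "set_decode a = set_decode b"
    by (auto simp: digit_def set_eq_iff of_bool_eq_iff)
  then show "a = b"
    by (metis set_decode_inverse)
qed simp

lemma digit_even_iff: "even (digit i a - digit i b) \<longleftrightarrow> digit i a = digit i b"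
  by (auto simp: digit_def)

lemma coordinates_Cons: "coordinates (a # w) i = digit i a - 2 * coordinates w i"
  by (simp add: coordinates_def)

lemma coordinates_Nil [simp]: "coordinates [] = (\<lambda>i. 0)"
  by (simp add: coordinates_def fun_eq_iff)

text \<open>Parity determines the lowest digit of each coordinate, hence the first letter; what
  remains, divided by \<open>-2\<close>, determines the tail.\<close>

lemma coordinates_Cons_eq_iff:
  "coordinates (a # u) = coordinates (b # v) \<longleftrightarrow> a = b \<and> coordinates u = coordinates v"
proof
  assume *: "coordinates (a # u) = coordinates (b # v)"
  have eq: "digit i a - 2 * coordinates u i = digit i b - 2 * coordinates v i" for i
    using fun_cong[OF *, of i] by (simp add: coordinates_Cons)
  have "digit i a = digit i b" for i
  proof -
    have "digit i a - digit i b = 2 * (coordinates u i - coordinates v i)"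
      using eq[of i] by simp
    then show ?thesis
      unfolding digit_even_iff[symmetric] by simp
  qed
  then show "a = b \<and> coordinates u = coordinates v"
    using eq digit_inject by (auto simp: fun_eq_iff)
qed (auto simp: coordinates_Cons fun_eq_iff)

lemma coordinates_eq_zero:
  assumes "canonical w" "coordinates w = coordinates []"
  shows "w = []"
  using assms
proof (induction w)
  case (Cons a w)
  \<comment> \<open>The noncanonical word \<open>[0]\<close> also has value zero; comparing with it
    peels off \<open>a\<close>, and the induction hypothesis then contradicts canonicity.\<close>
  have "coordinates (0 # []) = coordinates []"
    by (auto simp: coordinates_Cons)
  then have "coordinates (a # w) = coordinates (0 # [])"
    using Cons.prems by simp
  then show ?case
    using Cons by (auto simp: coordinates_Cons_eq_iff canonical_Cons)
qed simp

lemma coordinates_inject: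
  assumes "canonical u" "canonical v" "coordinates u = coordinates v"
  shows "u = v"
  using assms
proof (induction u arbitrary: v)
  case Nil
  then show ?case using coordinates_eq_zero[of v] by simp
next
  case (Cons a u)
  show ?case
  proof (cases v)
    case Nil
    then show ?thesis using Cons.prems coordinates_eq_zero[of "a # u"] by simp
  next
    case (Cons b v')
    then show ?thesis
      using Cons.prems Cons.IH[of v'] by (auto simp: coordinates_Cons_eq_iff canonical_Cons)
  qed
qed

lemma coordinates_eq_zero_outside:
  assumes "w \<in> lists (letters N)" "i \<ge> N"
  shows "coordinates w i = 0"
  using assms(1)
proof (induction w)
  case (Cons a w)
  then obtain S where "S \<subseteq> {..<N}" "a = set_encode S"
    by (auto simp: letters_def)
  then have "set_decode a \<subseteq> {..<N}"
    by (simp add: finite_subset)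
  then have "digit i a = 0"
    using assms(2) by (auto simp: digit_def)
  then show ?case
    using Cons by (simp add: coordinates_Cons)
qed simp

text \<open>Digit extraction does not decrease \<open>\<bar>x\<bar>\<close> for \<open>x = -1\<close>, which has quotient \<open>1\<close>;
  the summand for negative numbers repairs this.\<close>

lemma coordinates_surj:
  assumes "\<forall>i \<ge> N. v i = 0"
  obtains w where "w \<in> lists (letters N)" "canonical w" "coordinates w = v"
proof -
  define \<mu> where "\<mu> x = nat (2 * \<bar>x\<bar> + of_bool (x < 0))" for x :: int
  have \<mu>: "\<mu> ((x mod 2 - x) div 2) \<le> \<mu> x" "x \<noteq> 0 \<Longrightarrow> \<mu> ((x mod 2 - x) div 2) < \<mu> x" for x
    unfolding \<mu>_def by (auto simp: of_bool_def) presburger+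
  have "\<exists>w \<in> lists (letters N). canonical w \<and> coordinates w = v"
    using assms
  proof (induction "\<Sum>i<N. \<mu> (v i)" arbitrary: v rule: less_induct)
    case less
    show ?case
    proof (cases "\<forall>i. v i = 0")
      case True
      then show ?thesis by (intro bexI[of _ "[]"]) (auto simp: fun_eq_iff)
    next
      case False
      \<comment> \<open>The quotient by \<open>-2\<close> after the lowest digit is removed:
        \<open>v i = v i mod 2 - 2 * v' i\<close>.\<close>
      define v' where "v' i = (v i mod 2 - v i) div 2" for i
      define S where "S = {i. odd (v i)}"
      have S: "S \<subseteq> {..<N}"
        using less.prems by (force simp: S_def not_less[symmetric])
      obtain i where i: "v i \<noteq> 0" "i < N"
        using False less.prems by (metis not_less)
      have "(\<Sum>i<N. \<mu> (v' i)) < (\<Sum>i<N. \<mu> (v i))"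
        using i \<mu> by (intro sum_strict_mono_ex1) (auto simp: v'_def)
      moreover have "\<forall>i \<ge> N. v' i = 0"
        using less.prems by (simp add: v'_def)
      ultimately obtain w where w: "w \<in> lists (letters N)" "canonical w" "coordinates w = v'"
        using less.hyps by blast
      let ?w = "set_encode S # w"
      have "finite S"
        using S finite_subset by blast
      then have "coordinates ?w i = v i" for i
        by (auto simp: coordinates_Cons digit_def w(3) v'_def S_def) presburger+
      then have eq: "coordinates ?w = v" by auto
      moreover have "canonical ?w"
      proof -
        have "set_encode S \<noteq> 0" if "w = []"
        proof
          assume "set_encode S = 0"
          then have "coordinates ?w = (\<lambda>i. 0)"
            using that by (auto simp: coordinates_Cons)
          then show False using eq i by simp
        qed
        then show ?thesis using w by (simp add: canonical_Cons)
      qed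
      moreover have "?w \<in> lists (letters N)"
        using w(1) S by (auto simp: letters_def)
      ultimately show ?thesis by blast
    qed
  qed
  then show ?thesis using that by blast
qed

lemma bij_betw_coordinates:
  assumes "D \<subseteq> {v. \<forall>i \<ge> N. v i = 0}"
  shows "bij_betw coordinates {w \<in> lists (letters N). canonical w \<and> coordinates w \<in> D} D"
  unfolding bij_betw_def
proof
  show "inj_on coordinates {w \<in> lists (letters N). canonical w \<and> coordinates w \<in> D}"
    by (intro inj_onI coordinates_inject) auto
  show "coordinates ` {w \<in> lists (letters N). canonical w \<and> coordinates w \<in> D} = D"
  proof
    show "D \<subseteq> coordinates ` {w \<in> lists (letters N). canonical w \<and> coordinates w \<in> D}"
    proof
      fix v assume "v \<in> D"
      then have "\<forall>i \<ge> N. v i = 0"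
        using assms by blast
      then obtain w where "w \<in> lists (letters N)" "canonical w" "coordinates w = v"
        by (rule coordinates_surj)
      then show "v \<in> coordinates ` {w \<in> lists (letters N). canonical w \<and> coordinates w \<in> D}"
        using \<open>v \<in> D\<close> by (intro image_eqI[of _ _ w]) auto
    qed
  qed auto
qed

section \<open>Convolutions of two canonical words\<close>

fun convolution2 :: "'a list \<Rightarrow> 'a list \<Rightarrow> 'a option list list" where
  "convolution2 [] [] = []"
| "convolution2 (a # u) [] = [Some a, None] # convolution2 u []"
| "convolution2 [] (b # v) = [None, Some b] # convolution2 [] v"
| "convolution2 (a # u) (b # v) = [Some a, Some b] # convolution2 u v"

lemma convolution_pair:
  "convolution [u, v] = map (\<lambda>k. [if k < length u then Some (u ! k) else None,
     if k < length v then Some (v ! k) else None]) [0..<max (length u) (length v)]"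
  by (simp add: convolution_def)

lemma map_upt_Suc_eq: "map f [0..<Suc n] = f 0 # map (\<lambda>k. f (Suc k)) [0..<n]"
  by (simp add: upt_conv_Cons map_Suc_upt[symmetric] del: upt_Suc)

lemma convolution_eq_convolution2: "convolution [u, v] = convolution2 u v"
  unfolding convolution_pair
  by (induction u v rule: convolution2.induct) (simp_all add: map_upt_Suc_eq del: upt_Suc cong: if_cong)

lemma convolution2_eq_Nil_iff [simp]: "convolution2 u v = [] \<longleftrightarrow> u = [] \<and> v = []"
  by (cases u; cases v) auto

lemma hd_convolution2:
  "u \<noteq> [] \<or> v \<noteq> [] \<Longrightarrow> hd (convolution2 u v) =
     [if u = [] then None else Some (hd u), if v = [] then None else Some (hd v)]"
  by (cases u; cases v) auto

text \<open>Being a convolution of canonical words is a local property. A track that has ended stays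
  ended, and the pattern \<open>Some 0\<close>, \<open>None\<close> would be a word ending in the
  forbidden letter \<open>0\<close>. \<open>padding_end\<close> is the same test at the end of the
  input.\<close>

definition padding_step :: "nat option list \<Rightarrow> nat option list \<Rightarrow> bool" where
  "padding_step \<sigma> \<tau> \<longleftrightarrow> \<sigma> \<noteq> [None, None] \<and>
     (\<forall>t < 2. (\<sigma> ! t = None \<longrightarrow> \<tau> ! t = None) \<and> (\<sigma> ! t = Some 0 \<longrightarrow> \<tau> ! t \<noteq> None))"

definition padding_end :: "nat option list \<Rightarrow> bool" where
  "padding_end \<sigma> \<longleftrightarrow> \<sigma> \<noteq> [None, None] \<and> (\<forall>t < 2. \<sigma> ! t \<noteq> Some 0)"

definition well_padded :: "nat option list list \<Rightarrow> bool" where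
  "well_padded W \<longleftrightarrow> successively padding_step W \<and> (W = [] \<or> padding_end (last W))"

lemma well_padded_Nil [simp]: "well_padded []"
  by (simp add: well_padded_def)

lemma well_padded_Cons:
  "well_padded (\<sigma> # W) \<longleftrightarrow> well_padded W \<and>
     (if W = [] then padding_end \<sigma> else padding_step \<sigma> (hd W))"
  by (cases W) (auto simp: well_padded_def)

lemma well_padded_convolution2:
  "canonical u \<Longrightarrow> canonical v \<Longrightarrow> well_padded (convolution2 u v)"
  by (induction u v rule: convolution2.induct)
    (auto simp: well_padded_Cons canonical_Cons hd_convolution2 padding_step_def padding_end_def
      less_Suc_eq numeral_2_eq_2)

lemma convolution2_in_lists:
  "u \<in> lists \<Sigma> \<Longrightarrow> v \<in> lists \<Sigma> \<Longrightarrow> convolution2 u v \<in> lists (convolution_alphabet 2 \<Sigma>)"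
  by (induction u v rule: convolution2.induct) (auto simp: convolution_alphabet_def)

text \<open>Built from the back: each letter prepends its entries other than \<open>None\<close> to
  the two words. \<open>padding_step\<close> guarantees that a word whose track shows
  \<open>None\<close> is still empty at that moment.\<close>

lemma well_padded_imp_convolution2:
  assumes "W \<in> lists (convolution_alphabet 2 \<Sigma>)" "well_padded W"
  obtains u v where "u \<in> lists \<Sigma>" "v \<in> lists \<Sigma>" "canonical u" "canonical v" "W = convolution2 u v"
proof -
  have "\<exists>u\<in>lists \<Sigma>. \<exists>v\<in>lists \<Sigma>. canonical u \<and> canonical v \<and> W = convolution2 u v"
    using assms
  proof (induction W rule: list.induct)
    case Nil
    show ?case by (intro bexI[of _ "[]"]) auto
  next
    case (Cons \<sigma> W)
    have wp: "well_padded W" "W = [] \<Longrightarrow> padding_end \<sigma>" "W \<noteq> [] \<Longrightarrow> padding_step \<sigma> (hd W)"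
      using Cons.prems(2) by (auto simp: well_padded_Cons)
    obtain u v where uv: "u \<in> lists \<Sigma>" "v \<in> lists \<Sigma>" "canonical u" "canonical v" "W = convolution2 u v"
      using Cons wp by auto
    have "length \<sigma> = 2" and \<sigma>: "set \<sigma> \<subseteq> insert None (Some ` \<Sigma>)"
      using Cons.prems(1) by (auto simp: convolution_alphabet_def)
    then obtain x y where xy: "\<sigma> = [x, y]"
      by (auto simp: numeral_2_eq_2 length_Suc_conv)
    have ne: "x \<noteq> None \<or> y \<noteq> None"
      using wp(2,3) by (cases "W = []") (auto simp: padding_end_def padding_step_def xy)
    have u: "u = []" if "x = None"
      using wp(3) that by (cases "W = []") (auto simp: uv(5) hd_convolution2 padding_step_def xy
          less_Suc_eq numeral_2_eq_2 split: if_splits)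
    have v: "v = []" if "y = None"
      using wp(3) that by (cases "W = []") (auto simp: uv(5) hd_convolution2 padding_step_def xy
          less_Suc_eq numeral_2_eq_2 split: if_splits)
    have ux: "u = [] \<Longrightarrow> x \<noteq> Some 0"
      using wp(2,3) by (cases "W = []") (auto simp: uv(5) hd_convolution2 padding_step_def
          padding_end_def xy less_Suc_eq numeral_2_eq_2 split: if_splits)
    have vy: "v = [] \<Longrightarrow> y \<noteq> Some 0"
      using wp(2,3) by (cases "W = []") (auto simp: uv(5) hd_convolution2 padding_step_def
          padding_end_def xy less_Suc_eq numeral_2_eq_2 split: if_splits)
    let ?u = "case x of None \<Rightarrow> [] | Some a \<Rightarrow> a # u"
    let ?v = "case y of None \<Rightarrow> [] | Some b \<Rightarrow> b # v"
    have "?u \<in> lists \<Sigma>" "?v \<in> lists \<Sigma>"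
      using uv \<sigma> by (auto simp: xy split: option.split)
    moreover have "canonical ?u" "canonical ?v"
      using uv ux vy by (auto simp: canonical_Cons split: option.split)
    moreover have "\<sigma> # W = convolution2 ?u ?v"
      using ne u v by (auto simp: xy uv(5) split: option.split)
    ultimately show ?case by blast
  qed
  then show ?thesis using that by blast
qed

text \<open>Padding counts as digit \<open>0\<close>, which leaves the value unchanged. The reading
  is thereby a linear functional on all words over the convolution alphabet, including ill-padded
  ones.\<close>

definition track :: "nat \<Rightarrow> nat option list list \<Rightarrow> nat \<Rightarrow> int" where
  "track t W i = negabinary (map (\<lambda>\<sigma>. case \<sigma> ! t of None \<Rightarrow> 0 | Some a \<Rightarrow> digit i a) W)"

lemma track_convolution2 [simp]:
  "track 0 (convolution2 u v) = coordinates u" "track 1 (convolution2 u v) = coordinates v"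
proof -
  have "track 0 (convolution2 u v) i = coordinates u i \<and> track 1 (convolution2 u v) i = coordinates v i" for i
    by (induction u v rule: convolution2.induct) (auto simp: track_def coordinates_def)
  then show "track 0 (convolution2 u v) = coordinates u" "track 1 (convolution2 u v) = coordinates v"
    by auto
qed

lemma finite_convolution_alphabet: "finite \<Sigma> \<Longrightarrow> finite (convolution_alphabet n \<Sigma>)"
  using finite_lists_length_eq[of "insert None (Some ` \<Sigma>)" n]
  by (simp add: convolution_alphabet_def conj_commute)

text \<open>A bound \<open>0\<close> leaves the coordinate unrestricted.\<close>

definition mixed_box :: "nat \<Rightarrow> (nat \<Rightarrow> nat) \<Rightarrow> (nat \<Rightarrow> int) set" where
  "mixed_box N d = {v. (\<forall>i \<ge> N. v i = 0) \<and> (\<forall>i < N. d i > 0 \<longrightarrow> 0 \<le> v i \<and> v i < int (d i))}"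

section \<open>From arithmetic relations on a box to graph automaticity\<close>

lemma finite_residuals_eq:
  "finite A \<Longrightarrow> linear_functional A f \<Longrightarrow> finite_residuals A (\<lambda>w. f w = c)"
  using finite_residuals_dvd[of A f 0 "-c"] by simp

text \<open>A bounded range is written as a finite disjunction of equations, so that no automaton
  for inequalities is called for.\<close>

lemma finite_residuals_mixed_box:
  fixes N :: nat
  assumes "finite A" "\<And>i. linear_functional A (\<lambda>w. U w i)"
  shows "finite_residuals A (\<lambda>w. \<forall>i\<in>{..<N}. d i > 0 \<longrightarrow> (\<exists>c\<in>{0..<int (d i)}. U w i = c))"
  using assms by (intro finite_residuals_ball finite_residuals_imp finite_residuals_bex
      finite_residuals_eq finite_residuals_const) auto

text \<open>Quantifying over all linear readings \<open>U\<close>, \<open>V\<close> makes this a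
  property of relations between integer vectors, closed under Boolean operations without mention of
  words. The tracks of a convolution are substituted in
  \<open>graph_automatic_mixed_box\<close>.\<close>

definition recognizable_relation :: "((nat \<Rightarrow> int) \<Rightarrow> (nat \<Rightarrow> int) \<Rightarrow> bool) \<Rightarrow> bool" where
  "recognizable_relation Q \<longleftrightarrow>
     (\<forall>(A :: nat option list set) U V. finite A \<longrightarrow> (\<forall>i. linear_functional A (\<lambda>w. U w i)) \<longrightarrow>
        (\<forall>i. linear_functional A (\<lambda>w. V w i)) \<longrightarrow> finite_residuals A (\<lambda>w. Q (U w) (V w)))"

text \<open>The interface between automata and groups. \<open>Q\<close> has to agree with the edge
  relation on the box only, because the automaton checks padding and box membership of both tracks
  separately.\<close>

lemma graph_automatic_mixed_box:
  assumes fg: "finite_generating_set G X" "group G"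
    and bij: "bij_betw \<nu> (mixed_box N d) (carrier G)"
    and edge: "\<And>x. x \<in> X \<Longrightarrow> \<exists>Q. recognizable_relation Q \<and>
      (\<forall>u \<in> mixed_box N d. \<forall>v \<in> mixed_box N d. \<nu> u \<otimes>\<^bsub>G\<^esub> x = \<nu> v \<longleftrightarrow> Q u v)"
  shows "graph_automatic G"
proof -
  let ?D = "mixed_box N d"
  let ?\<Sigma> = "letters N"
  define R where "R = {w \<in> lists ?\<Sigma>. canonical w \<and> coordinates w \<in> ?D}"
  define B where "B f \<longleftrightarrow> (\<forall>i\<in>{..<N}. d i > 0 \<longrightarrow> (\<exists>c\<in>{0..<int (d i)}. f i = c))" for f
  have R_alt: "R = {w \<in> lists ?\<Sigma>. canonical w \<and> B (coordinates w)}"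
    unfolding R_def mixed_box_def B_def using coordinates_eq_zero_outside by auto
  have "finite_residuals ?\<Sigma> (\<lambda>w. canonical w \<and> B (coordinates w))"
    unfolding canonical_def B_def coordinates_def
    by (intro finite_residuals_conj finite_residuals_last finite_residuals_mixed_box
        finite_letters linear_functional_negabinary)
  then have reg: "regular_language ?\<Sigma> R"
    unfolding R_alt by (intro regular_language_residuals finite_letters)
  have "bij_betw coordinates R ?D"
    unfolding R_def by (rule bij_betw_coordinates) (auto simp: mixed_box_def)
  then have bij': "bij_betw (\<nu> \<circ> coordinates) R (carrier G)"
    using bij by (rule bij_betw_trans)
  have "FA_recognizable 2 ?\<Sigma> {[u, v] | u v. u \<in> R \<and> v \<in> R \<and>
      ((\<nu> \<circ> coordinates) u, (\<nu> \<circ> coordinates) v) \<in> cayley_edges G x}" (is "FA_recognizable _ _ ?E")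
    if "x \<in> X" for x
  proof -
    obtain Q where Q: "recognizable_relation Q"
      "\<And>u v. u \<in> ?D \<Longrightarrow> v \<in> ?D \<Longrightarrow> \<nu> u \<otimes>\<^bsub>G\<^esub> x = \<nu> v \<longleftrightarrow> Q u v"
      using edge[OF \<open>x \<in> X\<close>] by blast
    let ?A = "convolution_alphabet 2 ?\<Sigma>"
    have finA: "finite ?A"
      by (simp add: finite_convolution_alphabet finite_letters)
    have lin: "linear_functional ?A (\<lambda>W. track t W i)" for t i
      unfolding track_def by (rule linear_functional_negabinary)
    define P where "P W \<longleftrightarrow> well_padded W \<and> B (track 0 W) \<and> B (track 1 W) \<and> Q (track 0 W) (track 1 W)" for W
    have E: "?E = {[u, v] | u v. u \<in> R \<and> v \<in> R \<and> Q (coordinates u) (coordinates v)}"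
    proof -
      have "((\<nu> \<circ> coordinates) u, (\<nu> \<circ> coordinates) v) \<in> cayley_edges G x \<longleftrightarrow>
          Q (coordinates u) (coordinates v)" if "u \<in> R" "v \<in> R" for u v
      proof -
        have "\<nu> (coordinates u) \<in> carrier G"
          using bij_betwE[OF bij'] that(1) by simp
        moreover have "coordinates u \<in> ?D" "coordinates v \<in> ?D"
          using that by (auto simp: R_def)
        ultimately show ?thesis
          using Q(2)[of "coordinates u" "coordinates v"] by (auto simp: cayley_edges_def)
      qed
      then show ?thesis by blast
    qed
    have "convolution ` ?E = {W \<in> lists ?A. P W}"
    proof (intro equalityI subsetI)
      fix W assume "W \<in> convolution ` ?E"
      then obtain u v where uv: "W = convolution2 u v" "u \<in> R" "v \<in> R" "Q (coordinates u) (coordinates v)"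
        unfolding E by (auto simp: convolution_eq_convolution2)
      have "W \<in> lists ?A"
        unfolding uv(1) using uv(2,3) by (intro convolution2_in_lists) (auto simp: R_def)
      moreover have "P W"
        using uv well_padded_convolution2[of u v] unfolding P_def R_alt
        by (simp add: track_convolution2[simplified])
      ultimately show "W \<in> {W \<in> lists ?A. P W}" by blast
    next
      fix W assume W: "W \<in> {W \<in> lists ?A. P W}"
      then obtain u v where uv: "u \<in> lists ?\<Sigma>" "v \<in> lists ?\<Sigma>" "canonical u" "canonical v" "W = convolution2 u v"
        using well_padded_imp_convolution2[of W ?\<Sigma>] by (auto simp: P_def)
      then have "u \<in> R \<and> v \<in> R \<and> Q (coordinates u) (coordinates v)"
        using W unfolding R_alt P_def by (simp add: track_convolution2[simplified])
      then show "W \<in> convolution ` ?E"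
        unfolding E uv(5) convolution_eq_convolution2[symmetric] by blast
    qed
    moreover have "finite_residuals ?A P"
    proof -
      have "finite_residuals ?A (\<lambda>W. B (track t W))" for t
        unfolding B_def by (intro finite_residuals_mixed_box finA lin)
      moreover have "finite_residuals ?A (\<lambda>W. Q (track 0 W) (track 1 W))"
        using Q(1) finA lin unfolding recognizable_relation_def by blast
      ultimately show ?thesis
        unfolding P_def well_padded_def
        by (intro finite_residuals_conj finite_residuals_last finite_residuals_successively finA)
    qed
    ultimately have "regular_language ?A (convolution ` ?E)"
      using regular_language_residuals[OF finA, of P] by simp
    moreover have "?E \<subseteq> {ws. length ws = 2 \<and> set ws \<subseteq> lists ?\<Sigma>}"
      by (auto simp: R_def)
    ultimately show ?thesis
      unfolding FA_recognizable_def by simp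
  qed
  then have "graph_automatic_wrt G X"
    unfolding graph_automatic_wrt_def using fg(1) finite_letters reg bij' by blast
  then show ?thesis
    unfolding graph_automatic_def finitely_generated_group_def using fg by blast
qed

section \<open>Finitely generated abelian groups\<close>

context comm_group
begin

text \<open>Additively, an integer linear combination. As a map in \<open>m\<close> it is the
  presentation of the span of \<open>x\<close> as a quotient of a free abelian group.\<close>

definition combination :: "'i set \<Rightarrow> ('i \<Rightarrow> 'a) \<Rightarrow> ('i \<Rightarrow> int) \<Rightarrow> 'a" where
  "combination I x m = (\<Otimes>i\<in>I. x i [^] m i)"

lemma combination_closed [simp]: "x \<in> I \<rightarrow> carrier G \<Longrightarrow> combination I x m \<in> carrier G"
  unfolding combination_def by (intro finprod_closed) auto

lemma combination_cong:
  "x \<in> I \<rightarrow> carrier G \<Longrightarrow> (\<And>i. i \<in> I \<Longrightarrow> x i = y i) \<Longrightarrow> (\<And>i. i \<in> I \<Longrightarrow> m i = k i) \<Longrightarrow>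
    combination I x m = combination I y k"
  unfolding combination_def by (rule finprod_cong') (auto simp: Pi_iff)

lemma combination_insert:
  "finite I \<Longrightarrow> i \<notin> I \<Longrightarrow> x \<in> insert i I \<rightarrow> carrier G \<Longrightarrow>
    combination (insert i I) x m = x i [^] m i \<otimes> combination I x m"
  unfolding combination_def by (intro finprod_insert) auto

lemma combination_add:
  assumes "x \<in> I \<rightarrow> carrier G"
  shows "combination I x (\<lambda>i. m i + k i) = combination I x m \<otimes> combination I x k"
proof -
  have "(\<Otimes>i\<in>I. x i [^] (m i + k i)) = (\<Otimes>i\<in>I. x i [^] m i \<otimes> x i [^] k i)"
    using assms by (intro finprod_cong') (auto simp: Pi_iff int_pow_mult)
  also have "\<dots> = (\<Otimes>i\<in>I. x i [^] m i) \<otimes> (\<Otimes>i\<in>I. x i [^] k i)"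
    using assms by (intro finprod_multf) auto
  finally show ?thesis by (simp add: combination_def)
qed

lemma combination_scale:
  assumes "finite I" "x \<in> I \<rightarrow> carrier G"
  shows "combination I x (\<lambda>i. k * m i) = combination I x m [^] (k :: int)"
  using assms
proof (induction I rule: finite_induct)
  case empty
  then show ?case by (simp add: combination_def)
next
  case (insert i I)
  then have "x i \<in> carrier G" "x \<in> I \<rightarrow> carrier G" by auto
  with insert show ?case
    by (simp add: combination_insert int_pow_distrib int_pow_pow mult.commute)
qed

lemma combination_zero [simp]: "x \<in> I \<rightarrow> carrier G \<Longrightarrow> combination I x (\<lambda>i. 0) = \<one>"
  unfolding combination_def by (simp add: finprod_one_eqI)

text \<open>An elementary unimodular substitution: adding multiples of the other generators to
  \<open>x i\<close> changes each other coefficient \<open>p j\<close> by \<open>p i * q j\<close>.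
  It is the tool for reducing a relation modulo its \<open>i\<close>-th coefficient.\<close>

lemma combination_change_generator:
  assumes I: "finite I" "i \<in> I" and x: "x \<in> I \<rightarrow> carrier G"
  shows "combination I (x(i := x i \<otimes> combination (I - {i}) x q)) p =
    combination I x (\<lambda>j. if j = i then p i else p i * q j + p j)"
proof -
  let ?J = "I - {i}"
  let ?b = "combination ?J x q"
  let ?y = "x(i := x i \<otimes> ?b)"
  have J: "I = insert i ?J" "finite ?J" "i \<notin> ?J" "x \<in> ?J \<rightarrow> carrier G" "x i \<in> carrier G"
    using assms by auto
  have y: "?y \<in> I \<rightarrow> carrier G"
    using x J combination_closed[OF J(4)] by (auto simp: Pi_iff)
  have "combination I ?y p = ?y i [^] p i \<otimes> combination ?J ?y p"
    by (rule combination_insert[OF J(2,3), folded J(1)]) (rule y)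
  also have "combination ?J ?y p = combination ?J x p"
    using J(3,4) by (intro combination_cong[symmetric]) auto
  also have "?y i [^] p i \<otimes> combination ?J x p = x i [^] p i \<otimes> (?b [^] p i \<otimes> combination ?J x p)"
    using J by (simp add: int_pow_distrib m_assoc)
  also have "?b [^] p i \<otimes> combination ?J x p = combination ?J x (\<lambda>j. p i * q j + p j)"
    using J by (simp add: combination_scale combination_add)
  also have "\<dots> = combination ?J x (\<lambda>j. if j = i then p i else p i * q j + p j)"
    using J by (intro combination_cong) auto
  also have "x i [^] p i \<otimes> \<dots> = combination I x (\<lambda>j. if j = i then p i else p i * q j + p j)"
    using combination_insert[OF J(2,3), folded J(1), OF x, of "\<lambda>j. if j = i then p i else p i * q j + p j"]
    by simp
  finally show ?thesis .
qed

lemma range_combination_change_generator: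
  assumes I: "finite I" "i \<in> I" and x: "x \<in> I \<rightarrow> carrier G"
  shows "range (combination I (x(i := x i \<otimes> combination (I - {i}) x q))) = range (combination I x)"
proof (intro equalityI subsetI)
  fix g assume "g \<in> range (combination I (x(i := x i \<otimes> combination (I - {i}) x q)))"
  then show "g \<in> range (combination I x)"
    by (auto simp: combination_change_generator[OF assms])
next
  fix g assume "g \<in> range (combination I x)"
  then obtain p where p: "g = combination I x p" by auto
  \<comment> \<open>The inverse substitution: \<open>p i * q j\<close> is subtracted in
    advance.\<close>
  have "g = combination I (x(i := x i \<otimes> combination (I - {i}) x q))
      (\<lambda>j. if j = i then p i else p j - p i * q j)"
    unfolding combination_change_generator[OF assms] p using x by (intro combination_cong) auto
  then show "g \<in> range (combination I (x(i := x i \<otimes> combination (I - {i}) x q)))" by blast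
qed

text \<open>Among all generating tuples and all relations between them pick the least positive
  coefficient \<open>k\<close>. Division with remainder turns that relation into \<open>x i [^] k = \<one>\<close>, and makes
  \<open>k\<close> divide the \<open>i\<close>-th coefficient of every other relation, so \<open>x i\<close> splits off.\<close>

lemma independent_generators:
  fixes x :: "'i \<Rightarrow> 'a"
  assumes "finite I" "x \<in> I \<rightarrow> carrier G"
  obtains y and d :: "'i \<Rightarrow> nat" where "y \<in> I \<rightarrow> carrier G"
    "range (combination I y) = range (combination I x)"
    "\<And>m. combination I y m = \<one> \<longleftrightarrow> (\<forall>i\<in>I. int (d i) dvd m i)"
proof -
  have "\<exists>y (d :: 'i \<Rightarrow> nat). y \<in> I \<rightarrow> carrier G \<and> range (combination I y) = range (combination I x) \<and>
    (\<forall>m. combination I y m = \<one> \<longleftrightarrow> (\<forall>i\<in>I. int (d i) dvd m i))"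
    using assms
  proof (induction "card I" arbitrary: I x rule: less_induct)
    case less
    note I = \<open>finite I\<close> and x = \<open>x \<in> I \<rightarrow> carrier G\<close>
    define W where "W k \<longleftrightarrow> k > 0 \<and> (\<exists>x' m i. x' \<in> I \<rightarrow> carrier G \<and>
      range (combination I x') = range (combination I x) \<and> i \<in> I \<and> combination I x' m = \<one> \<and> m i = int k)" for k
    have W_I: "W (nat (m i))" if "x' \<in> I \<rightarrow> carrier G" "range (combination I x') = range (combination I x)"
      "i \<in> I" "combination I x' m = \<one>" "m i > 0" for x' m i
      unfolding W_def using that by (intro conjI exI[of _ x'] exI[of _ m] exI[of _ i]) auto
    show ?case
    proof (cases "\<exists>k. W k")
      \<comment> \<open>Relations can be negated, so without a positive coefficient there is only
        the trivial relation. The generators are free, and \<open>d = 0\<close> expresses this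
        because \<open>0 dvd m i\<close> means \<open>m i = 0\<close>.\<close>
      case False
      have "m i = 0" if "i \<in> I" "combination I x m = \<one>" for m i
      proof (rule ccontr)
        assume "m i \<noteq> 0"
        then consider "m i > 0" | "(-1) * m i > 0" by linarith
        then show False
        proof cases
          case 1
          then show False using W_I[OF x refl that] False by blast
        next
          case 2
          have "combination I x (\<lambda>i. (-1) * m i) = \<one>"
            unfolding combination_scale[OF I x] that(2) by simp
          then show False using W_I[OF x refl that(1)] 2 False by blast
        qed
      qed
      moreover have "combination I x m = \<one>" if "\<forall>i\<in>I. m i = 0" for m
        using combination_cong[of x I x m "\<lambda>_. 0"] that x by simp
      ultimately show ?thesis
        using x by (intro exI[of _ x] exI[of _ "\<lambda>_. 0"]) auto
    next
      case True
      define k where "k = (LEAST k. W k)"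
      have "W k" unfolding k_def using True by (rule LeastI_ex)
      have least: "\<not> W l" if "l < k" for l
        using not_less_Least that unfolding k_def by blast
      have k: "k > 0" using \<open>W k\<close> by (simp add: W_def)
      obtain x' m i where x': "x' \<in> I \<rightarrow> carrier G" "range (combination I x') = range (combination I x)"
        and i: "i \<in> I" "combination I x' m = \<one>" "m i = int k"
        using \<open>W k\<close> unfolding W_def by blast
      \<comment> \<open>Minimality of \<open>k\<close> in usable form: a remainder modulo
        \<open>k\<close> that occurs as a coefficient of a relation between generators of the same
        span is zero.\<close>
      have small: "r = 0" if "y \<in> I \<rightarrow> carrier G" "range (combination I y) = range (combination I x)"
        "j \<in> I" "combination I y p = \<one>" "p j = r" "r = s mod int k" for y p j r s
      proof (rule ccontr)
        assume "r \<noteq> 0"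
        moreover have "0 \<le> r" "r < int k"
          unfolding that(6) using k by simp_all
        ultimately have "r > 0" "nat r < k"
          by linarith+
        then show False
          using W_I[OF that(1-4)] least[of "nat r"] unfolding that(5) by blast
      qed
      let ?J = "I - {i}"
      have J: "I = insert i ?J" "finite ?J" "i \<notin> ?J" "card ?J < card I"
        using I i by (auto intro: card_Diff1_less simp del: card_Diff_insert)
      \<comment> \<open>With \<open>m i = k\<close>, the quotients \<open>m j div k\<close> are
        absorbed into the \<open>i\<close>-th generator; the relation \<open>m\<close> keeps
        coefficient \<open>k\<close> there and has the remainders elsewhere.\<close>
      define z where "z = x'(i := x' i \<otimes> combination ?J x' (\<lambda>j. m j div int k))"
      have z: "z \<in> I \<rightarrow> carrier G"
        using x'(1) i(1) combination_closed[of x' ?J] unfolding z_def by (auto simp: Pi_iff)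
      have zJ: "z \<in> ?J \<rightarrow> carrier G" and zi: "z i \<in> carrier G"
        using z i by auto
      have z_range: "range (combination I z) = range (combination I x)"
        unfolding z_def range_combination_change_generator[OF I i(1) x'(1)] x'(2) ..
      have insert_i: "combination I y p = y i [^] p i \<otimes> combination ?J y p" if "y \<in> I \<rightarrow> carrier G" for y p
        by (rule combination_insert[OF J(2,3), folded J(1)]) (rule that)
      define m2 where "m2 j = (if j = i then int k else m j mod int k)" for j
      have m2: "combination I z m2 = \<one>"
        unfolding z_def combination_change_generator[OF I i(1) x'(1)] i(2)[symmetric]
        using x'(1) i(3) by (intro combination_cong) (auto simp: m2_def)
      \<comment> \<open>All remainders vanish by minimality, so the relation shrinks to
        \<open>z i [^] k = \<one>\<close>.\<close>
      have "m2 j = 0" if "j \<in> ?J" for j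
        using small[OF z z_range _ m2 refl, of j "m j"] that by (auto simp: m2_def)
      then have "combination ?J z m2 = \<one>"
        using combination_cong[of z ?J z m2 "\<lambda>_. 0"] zJ by simp
      then have zk: "z i [^] int k = \<one>"
        using insert_i[OF z, of m2] m2 zi by (simp add: m2_def)
      have z_mult: "z i [^] (int k * c) = \<one>" for c
        using zk zi by (simp add: int_pow_pow[symmetric])
      obtain y' and d' :: "'i \<Rightarrow> nat" where y': "y' \<in> ?J \<rightarrow> carrier G"
        "range (combination ?J y') = range (combination ?J z)"
        "\<And>m. combination ?J y' m = \<one> \<longleftrightarrow> (\<forall>j\<in>?J. int (d' j) dvd m j)"
        using less.hyps[OF J(4,2) zJ] by blast
      define y where "y = y'(i := z i)"
      have y: "y \<in> I \<rightarrow> carrier G"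
        using y'(1) zi by (auto simp: y_def)
      have y_insert: "combination I y p = z i [^] p i \<otimes> combination ?J y' p" for p
        unfolding insert_i[OF y]
        using combination_cong[OF y'(1), of y p p] by (simp add: y_def)
      have upd: "combination I z (p(i := c)) = z i [^] c \<otimes> combination ?J z p" for c p
        unfolding insert_i[OF z] using combination_cong[OF zJ, of z "p(i := c)" p] by simp
      have updy: "combination I y (p(i := c)) = z i [^] c \<otimes> combination ?J y' p" for c p
        unfolding y_insert using combination_cong[OF y'(1), of y' "p(i := c)" p] by simp
      have "range (combination I y) = range (combination I z)"
      proof (intro equalityI subsetI)
        fix g assume "g \<in> range (combination I y)"
        then obtain p where p: "g = combination I y p" by auto
        have "combination ?J y' p \<in> range (combination ?J z)"
          unfolding y'(2)[symmetric] by (rule rangeI)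
        then obtain p' where "combination ?J y' p = combination ?J z p'"
          by (rule rangeE)
        then have "g = combination I z (p'(i := p i))"
          unfolding p y_insert upd by simp
        then show "g \<in> range (combination I z)" by blast
      next
        fix g assume "g \<in> range (combination I z)"
        then obtain p where p: "g = combination I z p" by auto
        have "combination ?J z p \<in> range (combination ?J y')"
          unfolding y'(2) by (rule rangeI)
        then obtain p' where "combination ?J z p = combination ?J y' p'"
          by (rule rangeE)
        then have "g = combination I y (p'(i := p i))"
          unfolding p insert_i[OF z] updy by simp
        then show "g \<in> range (combination I y)" by blast
      qed
      moreover have "combination I y p = \<one> \<longleftrightarrow> (\<forall>j\<in>I. int ((d'(i := k)) j) dvd p j)" for p
      proof -
        \<comment> \<open>The part outside \<open>i\<close> is rewritten in terms of
          \<open>z\<close>, and \<open>p i\<close> is reduced modulo \<open>k\<close>. This is a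
          relation for \<open>z\<close> with a remainder at \<open>i\<close>, so
          \<open>small\<close> applies.\<close>
        have "int k dvd p i" if rel: "combination I y p = \<one>"
        proof -
          have "combination ?J y' p \<in> range (combination ?J z)"
            unfolding y'(2)[symmetric] by (rule rangeI)
          then obtain p' where p': "combination ?J y' p = combination ?J z p'"
            by (rule rangeE)
          have "z i [^] p i = z i [^] (int k * (p i div int k)) \<otimes> z i [^] (p i mod int k)"
            using zi by (simp add: int_pow_mult[symmetric])
          then have "z i [^] p i = z i [^] (p i mod int k)"
            using zi by (simp add: z_mult)
          then have "combination I z (p'(i := p i mod int k)) = \<one>"
            using rel unfolding upd y_insert p' by simp
          then have "p i mod int k = 0"
            using small[OF z z_range i(1)] by simp
          then show ?thesis by (simp only: dvd_eq_mod_eq_0)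
        qed
        moreover have "combination I y p = combination ?J y' p" if dvd: "int k dvd p i"
        proof -
          obtain c where "p i = int k * c"
            using dvd unfolding dvd_def by blast
          then show ?thesis
            unfolding y_insert using y'(1) by (simp add: z_mult)
        qed
        moreover have "(\<forall>j\<in>I. int ((d'(i := k)) j) dvd p j) \<longleftrightarrow>
            int k dvd p i \<and> (\<forall>j\<in>?J. int (d' j) dvd p j)"
          using i(1) by auto
        ultimately show ?thesis
          unfolding y'(3)[symmetric] by argo
      qed
      ultimately show ?thesis
        using y z_range by (intro exI[of _ y] exI[of _ "d'(i := k)"]) auto
    qed
  qed
  then show ?thesis using that by blast
qed

lemma generate_eq_range_combination:
  assumes "finite I" "x \<in> I \<rightarrow> carrier G"
  shows "generate G (x ` I) = range (combination I x)"
proof (intro equalityI subsetI)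
  fix g assume "g \<in> generate G (x ` I)"
  then show "g \<in> range (combination I x)"
  proof induction
    case one
    show ?case using combination_zero[OF assms(2)] by (intro range_eqI[of _ _ "\<lambda>_. 0"]) simp
  next
    case (incl h)
    then obtain i where i: "i \<in> I" "h = x i" by auto
    have "combination I x (\<lambda>j. if j = i then 1 else 0) = (\<Otimes>j\<in>I. if i = j then x j else \<one>)"
      unfolding combination_def using assms by (intro finprod_cong') (auto simp: Pi_iff)
    also have "\<dots> = h"
      using assms i by (subst finprod_singleton) auto
    finally show ?case by (intro range_eqI[of _ _ "\<lambda>j. if j = i then 1 else 0"]) (rule sym)
  next
    case (inv h)
    then obtain i where i: "i \<in> I" "h = x i" by auto
    have "combination I x (\<lambda>j. if j = i then -1 else 0) = (\<Otimes>j\<in>I. if i = j then inv (x j) else \<one>)"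
      unfolding combination_def using assms by (intro finprod_cong') (auto simp: Pi_iff int_pow_neg)
    also have "\<dots> = inv h"
      using assms i by (subst finprod_singleton) auto
    finally show ?case by (intro range_eqI[of _ _ "\<lambda>j. if j = i then -1 else 0"]) (rule sym)
  next
    case (eng g h)
    then obtain m k where "g = combination I x m" "h = combination I x k"
      by blast
    then show ?case
      using combination_add[OF assms(2)] by (intro range_eqI[of _ _ "\<lambda>i. m i + k i"]) simp
  qed
next
  fix g assume "g \<in> range (combination I x)"
  then obtain m where "g = combination I x m" by auto
  moreover have "combination I x m \<in> generate G (x ` I)"
  proof -
    interpret H: subgroup "generate G (x ` I)" G
      using assms(2) by (intro generate_is_subgroup) auto
    have mem: "x i [^] m i \<in> generate G (x ` I)" if "i \<in> I" for i
      using that assms(2) by (intro subgroup_int_pow_closed H.subgroup_axioms generate.incl) auto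
    have "finprod G (\<lambda>i. x i [^] m i) J \<in> generate G (x ` I)" if "finite J" "J \<subseteq> I" for J
      using that
    proof (induction J rule: finite_induct)
      case (insert j J)
      moreover have "(\<lambda>i. x i [^] m i) \<in> J \<rightarrow> carrier G" "x j [^] m j \<in> carrier G"
        using insert.prems assms(2) by auto
      ultimately show ?case
        using mem[of j] by simp
    qed simp
    then show ?thesis
      using assms(1) unfolding combination_def by blast
  qed
  ultimately show "g \<in> generate G (x ` I)" by simp
qed

end

section \<open>Groups of class two\<close>

text \<open>The collected word \<open>x 0 [^] m 0\<close>, ...,
  \<open>x (n - 1) [^] m (n - 1)\<close>. Outside commutative groups the order of the factors
  matters; inside them this is \<open>combination\<close>.\<close>

primrec ordered_product :: "('g, 'm) monoid_scheme \<Rightarrow> (nat \<Rightarrow> 'g) \<Rightarrow> (nat \<Rightarrow> int) \<Rightarrow> nat \<Rightarrow> 'g" where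
  "ordered_product G x m 0 = \<one>\<^bsub>G\<^esub>"
| "ordered_product G x m (Suc n) = ordered_product G x m n \<otimes>\<^bsub>G\<^esub> x n [^]\<^bsub>G\<^esub> m n"

lemma ordered_product_cong:
  "(\<And>i. i < n \<Longrightarrow> x i = y i) \<Longrightarrow> (\<And>i. i < n \<Longrightarrow> m i = k i) \<Longrightarrow>
    ordered_product G x m n = ordered_product G y k n"
  by (induction n) auto

lemma (in group) ordered_product_closed [simp]:
  "x \<in> {..<n} \<rightarrow> carrier G \<Longrightarrow> ordered_product G x m n \<in> carrier G"
  by (induction n) (auto simp: Pi_iff)

lemma (in group) ordered_product_single:
  "x \<in> {..<n} \<rightarrow> carrier G \<Longrightarrow>
    ordered_product G x (\<lambda>i. if i = j then t else 0) n = (if j < n then x j [^] t else \<one>)"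
  by (induction n) (auto simp: Pi_iff less_Suc_eq)

lemma (in comm_group) ordered_product_eq_combination:
  assumes "x \<in> {..<n} \<rightarrow> carrier G"
  shows "ordered_product G x m n = combination {..<n} x m"
  using assms
proof (induction n)
  case (Suc n)
  then have "x \<in> {..<n} \<rightarrow> carrier G" "x n \<in> carrier G" by auto
  moreover have "combination {..<n} x m \<in> carrier G" if "x \<in> {..<n} \<rightarrow> carrier G"
    using that by (rule combination_closed)
  ultimately show ?case
    using Suc combination_insert[of "{..<n}" n x m]
    by (simp add: lessThan_Suc m_comm)
qed (simp add: combination_def)

lemma (in group) ordered_product_subgroup:
  assumes "subgroup H G" "x \<in> {..<n} \<rightarrow> H"
  shows "ordered_product (G\<lparr>carrier := H\<rparr>) x m n = ordered_product G x m n"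
  using assms(2) by (induction n) (auto simp: Pi_iff int_pow_consistent[OF assms(1)])

lemma (in group_hom) hom_ordered_product:
  assumes "x \<in> {..<n} \<rightarrow> carrier G"
  shows "h (ordered_product G x m n) = ordered_product H (h \<circ> x) m n"
  using assms
proof (induction n)
  case (Suc n)
  then have "x \<in> {..<n} \<rightarrow> carrier G" "x n \<in> carrier G" by auto
  with Suc show ?case by (simp add: hom_int_pow)
qed simp

locale class_two_group = group G for G (structure) +
  assumes derived_central: "z \<in> derived G (carrier G) \<Longrightarrow> g \<in> carrier G \<Longrightarrow> z \<otimes> g = g \<otimes> z"
begin

abbreviation Z where "Z \<equiv> derived G (carrier G)"

definition commutator :: "'a \<Rightarrow> 'a \<Rightarrow> 'a" where
  "commutator g h = g \<otimes> h \<otimes> inv g \<otimes> inv h"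

lemma subgroup_Z: "subgroup Z G"
  by (rule derived_is_subgroup) simp

lemma Z_carrier: "z \<in> Z \<Longrightarrow> z \<in> carrier G"
  using subgroup.mem_carrier[OF subgroup_Z] .

lemma commutator_in_Z: "g \<in> carrier G \<Longrightarrow> h \<in> carrier G \<Longrightarrow> commutator g h \<in> Z"
  unfolding derived_def commutator_def by (intro generate.incl) blast

lemma commutator_closed [simp]: "g \<in> carrier G \<Longrightarrow> h \<in> carrier G \<Longrightarrow> commutator g h \<in> carrier G"
  using commutator_in_Z Z_carrier by blast

lemma mult_swap_commutator:
  assumes "g \<in> carrier G" "h \<in> carrier G"
  shows "g \<otimes> h = h \<otimes> g \<otimes> commutator g h"
proof -
  have "g \<otimes> h = commutator g h \<otimes> (h \<otimes> g)"
  proof -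
    have "inv h \<otimes> (h \<otimes> g) = g"
      using assms by (simp add: m_assoc[symmetric])
    then show ?thesis
      unfolding commutator_def using assms by (simp add: m_assoc)
  qed
  also have "\<dots> = h \<otimes> g \<otimes> commutator g h"
    by (intro derived_central commutator_in_Z m_closed assms)
  finally show ?thesis .
qed

lemma commutator_eqI:
  assumes "g \<in> carrier G" "h \<in> carrier G" "c \<in> carrier G" "g \<otimes> h = h \<otimes> g \<otimes> c"
  shows "commutator g h = c"
  using mult_swap_commutator[OF assms(1,2)] assms by (metis Units_eq Units_l_cancel commutator_closed m_closed)

text \<open>\<open>h\<close> is carried past \<open>g'\<close> and then past \<open>g\<close>; the
  central \<open>commutator g h\<close> slips past \<open>g'\<close>.\<close>

lemma commutator_mult_left:
  assumes "g \<in> carrier G" "g' \<in> carrier G" "h \<in> carrier G"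
  shows "commutator (g \<otimes> g') h = commutator g h \<otimes> commutator g' h"
proof (rule commutator_eqI)
  have "g \<otimes> g' \<otimes> h = g \<otimes> (h \<otimes> g' \<otimes> commutator g' h)"
    using assms mult_swap_commutator[of g' h] by (simp add: m_assoc)
  also have "\<dots> = (g \<otimes> h) \<otimes> (g' \<otimes> commutator g' h)"
    using assms by (simp add: m_assoc)
  also have "\<dots> = h \<otimes> g \<otimes> (commutator g h \<otimes> g') \<otimes> commutator g' h"
    using assms mult_swap_commutator[of g h] by (simp add: m_assoc)
  also have "commutator g h \<otimes> g' = g' \<otimes> commutator g h"
    by (intro derived_central commutator_in_Z assms)
  finally show "g \<otimes> g' \<otimes> h = h \<otimes> (g \<otimes> g') \<otimes> (commutator g h \<otimes> commutator g' h)"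
    using assms by (simp add: m_assoc)
qed (use assms in auto)

lemma commutator_hom: "h \<in> carrier G \<Longrightarrow> (\<lambda>g. commutator g h) \<in> hom G G"
  by (auto simp: hom_def commutator_mult_left)

lemma commutator_group_hom: "h \<in> carrier G \<Longrightarrow> group_hom G G (\<lambda>g. commutator g h)"
  by (intro group_hom.intro group_hom_axioms.intro commutator_hom is_group)

lemma commutator_int_pow:
  "g \<in> carrier G \<Longrightarrow> h \<in> carrier G \<Longrightarrow> commutator (g [^] (m :: int)) h = commutator g h [^] m"
  using group_hom.hom_int_pow[OF commutator_group_hom] by blast

lemma commutator_flip:
  assumes "g \<in> carrier G" "h \<in> carrier G"
  shows "commutator h g = inv (commutator g h)"
  using assms by (simp add: commutator_def inv_mult_group m_assoc)

text \<open>For fixed \<open>h\<close>, taking the commutator with \<open>h\<close> is an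
  endomorphism, so it maps the group generated by \<open>X\<close> into any subgroup containing the
  images of \<open>X\<close>.\<close>

lemma commutator_generate:
  assumes X: "X \<subseteq> carrier G" "generate G X = carrier G" and K: "subgroup K G"
    and h: "h \<in> carrier G" "\<And>x. x \<in> X \<Longrightarrow> commutator x h \<in> K" and g: "g \<in> carrier G"
  shows "commutator g h \<in> K"
proof -
  interpret \<phi>: group_hom G G "\<lambda>g. commutator g h"
    using h(1) by (rule commutator_group_hom)
  have "(\<lambda>g. commutator g h) ` generate G X = generate G ((\<lambda>g. commutator g h) ` X)"
    by (rule \<phi>.generate_img[OF X(1), symmetric])
  also have "\<dots> \<subseteq> K"
    using h(2) by (intro generate_subgroup_incl K) auto
  finally show ?thesis
    using X g by auto
qed

text \<open>Extend from \<open>X\<close> to the whole group in the first argument, exchange the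
  arguments at the cost of an inverse, and extend again. This is why \<open>Z\<close> is finitely
  generated when \<open>X\<close> is finite.\<close>

lemma derived_eq_generate_commutators:
  assumes X: "X \<subseteq> carrier G" "generate G X = carrier G"
  shows "Z = generate G ((\<lambda>(x, y). commutator x y) ` (X \<times> X))" (is "_ = ?K")
proof
  have sub: "(\<lambda>(x, y). commutator x y) ` (X \<times> X) \<subseteq> Z"
    using X(1) by (auto intro!: commutator_in_Z)
  then show "?K \<subseteq> Z"
    by (intro generate_subgroup_incl subgroup_Z)
  have K: "subgroup ?K G"
    using sub Z_carrier by (intro generate_is_subgroup) blast
  have 1: "commutator g y \<in> ?K" if "g \<in> carrier G" "y \<in> X" for g y
  proof (rule commutator_generate[OF X K _ _ that(1)])
    show "y \<in> carrier G" using that(2) X(1) by blast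
    show "commutator x y \<in> ?K" if "x \<in> X" for x
      using that \<open>y \<in> X\<close> by (intro generate.incl image_eqI[of _ _ "(x, y)"]) simp_all
  qed
  have 2: "commutator x h \<in> ?K" if "x \<in> X" "h \<in> carrier G" for x h
  proof -
    have "x \<in> carrier G" using that(1) X(1) by blast
    then have "commutator x h = inv (commutator h x)"
      using that(2) by (intro commutator_flip)
    then show ?thesis
      using subgroup.m_inv_closed[OF K 1[OF that(2,1)]] by (simp only:)
  qed
  have 3: "commutator g h \<in> ?K" if "g \<in> carrier G" "h \<in> carrier G" for g h
    by (rule commutator_generate[OF X K that(2) _ that(1)]) (rule 2[OF _ that(2)])
  show "Z \<subseteq> ?K"
    unfolding derived_def by (intro generate_subgroup_incl K) (use 3 in \<open>force simp: commutator_def\<close>)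
qed

lemma comm_group_Z: "comm_group (G\<lparr>carrier := Z\<rparr>)"
proof (rule group.group_comm_groupI)
  show "group (G\<lparr>carrier := Z\<rparr>)"
    by (rule subgroup.subgroup_is_group[OF subgroup_Z is_group])
next
  fix x y assume "x \<in> carrier (G\<lparr>carrier := Z\<rparr>)" "y \<in> carrier (G\<lparr>carrier := Z\<rparr>)"
  then show "x \<otimes>\<^bsub>G\<lparr>carrier := Z\<rparr>\<^esub> y = y \<otimes>\<^bsub>G\<lparr>carrier := Z\<rparr>\<^esub> x"
    using derived_central[of x y] Z_carrier[of y] by simp
qed

lemma obtain_derived_generators:
  assumes "finite_generating_set G X"
  obtains c :: "nat \<Rightarrow> 'a" and e :: "nat \<Rightarrow> nat" and r where "c \<in> {..<r} \<rightarrow> Z"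
    "Z = range (\<lambda>l. ordered_product G c l r)"
    "\<And>l. ordered_product G c l r = \<one> \<longleftrightarrow> (\<forall>k<r. int (e k) dvd l k)"
proof -
  let ?Z = "G\<lparr>carrier := Z\<rparr>"
  interpret Z: comm_group ?Z by (rule comm_group_Z)
  let ?C = "(\<lambda>(x, y). commutator x y) ` (X \<times> X)"
  have X: "finite X" "X \<subseteq> carrier G" "generate G X = carrier G"
    using assms by (auto simp: finite_generating_set_def)
  have CZ: "?C \<subseteq> Z"
    using X(2) by (auto intro!: commutator_in_Z)
  have "finite ?C" using X(1) by simp
  then obtain r :: nat and f where f: "?C = f ` {..<r}"
    unfolding lessThan_def using finite_imp_nat_seg_image_inj_on by metis
  have fZ: "f \<in> {..<r} \<rightarrow> carrier ?Z"
    using CZ f by auto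
  obtain c and e :: "nat \<Rightarrow> nat" where c: "c \<in> {..<r} \<rightarrow> carrier ?Z"
    "range (Z.combination {..<r} c) = range (Z.combination {..<r} f)"
    "\<And>l. Z.combination {..<r} c l = \<one>\<^bsub>?Z\<^esub> \<longleftrightarrow> (\<forall>k\<in>{..<r}. int (e k) dvd l k)"
    using Z.independent_generators[OF finite_lessThan fZ] by blast
  have eq: "ordered_product G c l r = Z.combination {..<r} c l" for l
    using Z.ordered_product_eq_combination[OF c(1)] ordered_product_subgroup[OF subgroup_Z, of c r] c(1)
    by simp
  have "Z = generate ?Z (f ` {..<r})"
    unfolding f[symmetric] generate_consistent[OF CZ subgroup_Z]
    by (rule derived_eq_generate_commutators[OF X(2,3)])
  also have "\<dots> = range (Z.combination {..<r} f)"
    by (rule Z.generate_eq_range_combination[OF finite_lessThan fZ])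
  finally have "Z = range (\<lambda>l. ordered_product G c l r)"
    unfolding eq c(2) .
  then show thesis
    using c(1,3) by (intro that[of c r e]) (simp_all add: eq Ball_def)
qed

lemma normal_Z: "Z \<lhd> G"
  by (rule derived_is_normal) (rule normal_self)

text \<open>The \<open>a i\<close> are arbitrary preimages of independent generators of
  \<open>G Mod Z\<close>. Equality of cosets is spelled out in \<open>G\<close> as equality up to a
  factor in \<open>Z\<close>.\<close>

lemma obtain_abelianization_generators:
  assumes "finite_generating_set G X"
  obtains a :: "nat \<Rightarrow> 'a" and d :: "nat \<Rightarrow> nat" and n where "a \<in> {..<n} \<rightarrow> carrier G"
    "\<And>g. g \<in> carrier G \<Longrightarrow> \<exists>m. \<exists>z\<in>Z. g = ordered_product G a m n \<otimes> z"
    "\<And>m k. (\<exists>z\<in>Z. ordered_product G a m n = ordered_product G a k n \<otimes> z) \<longleftrightarrow>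
       (\<forall>i<n. int (d i) dvd m i - k i)"
proof -
  let ?Q = "G Mod Z"
  let ?p = "\<lambda>g. Z #> g"
  interpret Q: comm_group ?Q by (rule derived_quot_is_comm_group)
  interpret N: normal Z G by (rule normal_Z)
  interpret p: group_hom G ?Q ?p
    by (intro group_hom.intro group_hom_axioms.intro is_group Q.is_group N.r_coset_hom_Mod)
  have X: "finite X" "X \<subseteq> carrier G" "generate G X = carrier G"
    using assms by (auto simp: finite_generating_set_def)
  obtain n :: nat and f where f: "X = f ` {..<n}"
    unfolding lessThan_def using finite_imp_nat_seg_image_inj_on[OF X(1)] by metis
  have pf: "?p \<circ> f \<in> {..<n} \<rightarrow> carrier ?Q"
    using X(2) f by auto
  obtain b and d :: "nat \<Rightarrow> nat" where b: "b \<in> {..<n} \<rightarrow> carrier ?Q"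
    "range (Q.combination {..<n} b) = range (Q.combination {..<n} (?p \<circ> f))"
    "\<And>m. Q.combination {..<n} b m = \<one>\<^bsub>?Q\<^esub> \<longleftrightarrow> (\<forall>i\<in>{..<n}. int (d i) dvd m i)"
    using Q.independent_generators[OF finite_lessThan pf] by blast
  have surj: "?p ` carrier G = carrier ?Q"
    by (auto simp: FactGroup_def RCOSETS_def)
  have "\<exists>g\<in>carrier G. ?p g = b i" if "i < n" for i
  proof -
    have "b i \<in> ?p ` carrier G"
      unfolding surj using b(1) that by auto
    then show ?thesis by blast
  qed
  then obtain a where a: "\<And>i. i < n \<Longrightarrow> a i \<in> carrier G" "\<And>i. i < n \<Longrightarrow> ?p (a i) = b i"
    by metis
  have a_car: "a \<in> {..<n} \<rightarrow> carrier G" using a(1) by auto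
  have pa: "?p (ordered_product G a m n) = Q.combination {..<n} b m" for m
  proof -
    have "?p (ordered_product G a m n) = ordered_product ?Q (?p \<circ> a) m n"
      by (rule p.hom_ordered_product[OF a_car])
    also have "\<dots> = ordered_product ?Q b m n"
      using a(2) by (intro ordered_product_cong) auto
    finally show ?thesis
      using Q.ordered_product_eq_combination[OF b(1)] by simp
  qed
  \<comment> \<open>Cosets put the factor from \<open>Z\<close> on the left, normal forms on the
    right; centrality reconciles the two.\<close>
  have same: "?p g = ?p h \<longleftrightarrow> (\<exists>z\<in>Z. g = h \<otimes> z)" if gh: "g \<in> carrier G" "h \<in> carrier G" for g h
  proof
    assume "?p g = ?p h"
    then have "g \<in> Z #> h"
      using rcos_self[OF gh(1) subgroup_Z] by simp
    then obtain z where "z \<in> Z" "g = z \<otimes> h"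
      by (auto simp: r_coset_def)
    then show "\<exists>z\<in>Z. g = h \<otimes> z"
      using derived_central[OF _ gh(2)] by (intro bexI[of _ z]) simp_all
  next
    assume "\<exists>z\<in>Z. g = h \<otimes> z"
    then obtain z where z: "z \<in> Z" "g = z \<otimes> h"
      using derived_central[OF _ gh(2)] by force
    then have "g \<in> Z #> h"
      by (auto simp: r_coset_def)
    then show "?p g = ?p h"
      using repr_independence[OF _ gh(2) subgroup_Z] by simp
  qed
  have "carrier ?Q = ?p ` generate G X"
    using surj X(3) by simp
  also have "\<dots> = generate ?Q ((?p \<circ> f) ` {..<n})"
    using p.generate_img[OF X(2)] unfolding f image_comp by (rule sym)
  also have "\<dots> = range (Q.combination {..<n} b)"
    using Q.generate_eq_range_combination[OF finite_lessThan pf] b(2) by simp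
  finally have Qr: "carrier ?Q = range (Q.combination {..<n} b)" .
  show thesis
  proof (rule that[OF a_car])
    fix g assume g: "g \<in> carrier G"
    then have "?p g \<in> range (Q.combination {..<n} b)"
      using Qr surj by blast
    then obtain m where "?p g = ?p (ordered_product G a m n)"
      unfolding pa by blast
    then show "\<exists>m. \<exists>z\<in>Z. g = ordered_product G a m n \<otimes> z"
      using same g a_car by auto
  next
    fix m k
    have "(\<exists>z\<in>Z. ordered_product G a m n = ordered_product G a k n \<otimes> z) \<longleftrightarrow>
        Q.combination {..<n} b m = Q.combination {..<n} b k"
      using same[of "ordered_product G a m n" "ordered_product G a k n"] a_car by (simp add: pa)
    also have "Q.combination {..<n} b m = Q.combination {..<n} b k \<otimes>\<^bsub>?Q\<^esub> Q.combination {..<n} b (\<lambda>i. m i - k i)"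
      using Q.combination_add[OF b(1), of k "\<lambda>i. m i - k i"] by simp
    also have "\<dots> = Q.combination {..<n} b k \<longleftrightarrow> Q.combination {..<n} b (\<lambda>i. m i - k i) = \<one>\<^bsub>?Q\<^esub>"
      by (intro Q.l_cancel_one Q.combination_closed b(1))
    finally show "(\<exists>z\<in>Z. ordered_product G a m n = ordered_product G a k n \<otimes> z) \<longleftrightarrow>
       (\<forall>i<n. int (d i) dvd m i - k i)"
      using b(3) by (simp add: Ball_def)
  qed
qed

end

section \<open>Normal forms and edge relations\<close>

lemma mixed_boxD:
  "v \<in> mixed_box N d \<Longrightarrow> i < N \<Longrightarrow> 0 < d i \<Longrightarrow> 0 \<le> v i \<and> v i < int (d i)"
  by (simp add: mixed_box_def)

lemma mixed_box_eqI:
  assumes "u \<in> mixed_box N d" "v \<in> mixed_box N d" "i < N" "int (d i) dvd u i - v i"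
  shows "u i = v i"
proof (cases "d i = 0")
  case False
  then have "0 \<le> u i \<and> u i < int (d i)" "0 \<le> v i \<and> v i < int (d i)"
    using assms(1-3) by (auto simp: mixed_box_def)
  then have "\<bar>u i - v i\<bar> < int (d i)"
    by linarith
  moreover have "\<bar>int (d i)\<bar> \<le> \<bar>u i - v i\<bar>" if "u i - v i \<noteq> 0"
    using that assms(4) by (rule dvd_imp_le_int)
  ultimately show ?thesis by linarith
qed (use assms in simp)

section \<open>Boolean combinations of recognizable relations\<close>

lemma recognizable_relationI:
  assumes "\<And>(A :: nat option list set) U V. finite A \<Longrightarrow> (\<And>i. linear_functional A (\<lambda>w. U w i)) \<Longrightarrow>
    (\<And>i. linear_functional A (\<lambda>w. V w i)) \<Longrightarrow> finite_residuals A (\<lambda>w. Q (U w) (V w))"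
  shows "recognizable_relation Q"
  unfolding recognizable_relation_def
proof (intro allI impI)
  fix A :: "nat option list set" and U V :: "nat option list list \<Rightarrow> nat \<Rightarrow> int"
  assume "finite A" "\<forall>i. linear_functional A (\<lambda>w. U w i)" "\<forall>i. linear_functional A (\<lambda>w. V w i)"
  then show "finite_residuals A (\<lambda>w. Q (U w) (V w))"
    using assms[of A U V] by simp
qed

lemma recognizable_relationD:
  fixes A :: "nat option list set"
  assumes "recognizable_relation Q" "finite A" "\<And>i. linear_functional A (\<lambda>w. U w i)"
    "\<And>i. linear_functional A (\<lambda>w. V w i)"
  shows "finite_residuals A (\<lambda>w. Q (U w) (V w))"
  by (rule assms(1)[unfolded recognizable_relation_def, rule_format, of A U V]) (fact assms)+

lemma recognizable_relation_conj:
  assumes "recognizable_relation P" "recognizable_relation Q"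
  shows "recognizable_relation (\<lambda>u v. P u v \<and> Q u v)"
  by (intro recognizable_relationI finite_residuals_conj recognizable_relationD[OF assms(1)]
      recognizable_relationD[OF assms(2)])

lemma recognizable_relation_imp:
  assumes "recognizable_relation P" "recognizable_relation Q"
  shows "recognizable_relation (\<lambda>u v. P u v \<longrightarrow> Q u v)"
  by (intro recognizable_relationI finite_residuals_imp recognizable_relationD[OF assms(1)]
      recognizable_relationD[OF assms(2)])

lemma recognizable_relation_not:
  assumes "recognizable_relation P"
  shows "recognizable_relation (\<lambda>u v. \<not> P u v)"
  by (intro recognizable_relationI finite_residuals_not recognizable_relationD[OF assms])

lemma recognizable_relation_all:
  fixes n :: nat
  assumes "\<And>i. i < n \<Longrightarrow> recognizable_relation (P i)"
  shows "recognizable_relation (\<lambda>u v. \<forall>i<n. P i u v)"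
proof (rule recognizable_relationI)
  fix A :: "nat option list set" and U V :: "nat option list list \<Rightarrow> nat \<Rightarrow> int"
  assume A: "finite A" "\<And>i. linear_functional A (\<lambda>w. U w i)" "\<And>i. linear_functional A (\<lambda>w. V w i)"
  have "finite_residuals A (\<lambda>w. \<forall>i\<in>{..<n}. P i (U w) (V w))"
    by (intro finite_residuals_ball finite_lessThan recognizable_relationD[OF assms] A) simp
  then show "finite_residuals A (\<lambda>w. \<forall>i<n. P i (U w) (V w))"
    by (simp only: Ball_def lessThan_iff)
qed

text \<open>The one atomic formula of the edge relations, shaped so that a single rule serves all
  uses: an empty sum (\<open>n = 0\<close>) drops the linear form, and \<open>e = 0\<close> turns
  the congruence into an equation.\<close>

lemma recognizable_relation_dvd:
  "recognizable_relation (\<lambda>u v. e dvd (\<Sum>i<n. u i * \<beta> i) + u j + b - v k)"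
proof -
  have "recognizable_relation (\<lambda>u v. e dvd (\<Sum>i<n. u i * \<beta> i) + u j - v k + b)"
    by (intro recognizable_relationI finite_residuals_dvd linear_functional_add
        linear_functional_diff linear_functional_sum linear_functional_mult)
  moreover have "x + y - z + b = x + y + b - z" for x y z :: int
    by simp
  ultimately show ?thesis
    by (simp only:)
qed

text \<open>\<open>d i\<close> is the order of \<open>a i\<close> modulo \<open>Z\<close> and
  \<open>e k\<close> the order of \<open>c k\<close>, with \<open>0\<close> standing for infinite
  order.\<close>

locale class_two_normal_form = class_two_group +
  fixes a :: "nat \<Rightarrow> 'a" and d :: "nat \<Rightarrow> nat" and n :: nat
    and c :: "nat \<Rightarrow> 'a" and e :: "nat \<Rightarrow> nat" and r :: nat
  assumes a_closed: "a \<in> {..<n} \<rightarrow> carrier G"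
    and a_surj: "g \<in> carrier G \<Longrightarrow> \<exists>m. \<exists>z\<in>Z. g = ordered_product G a m n \<otimes> z"
    and a_cong: "(\<exists>z\<in>Z. ordered_product G a m n = ordered_product G a k n \<otimes> z) \<longleftrightarrow>
       (\<forall>i<n. int (d i) dvd m i - k i)"
    and c_in_Z: "c \<in> {..<r} \<rightarrow> Z"
    and Z_range: "Z = range (\<lambda>l. ordered_product G c l r)"
    and c_eq_one: "ordered_product G c l r = \<one> \<longleftrightarrow> (\<forall>k<r. int (e k) dvd l k)"
begin

abbreviation apow where "apow m \<equiv> ordered_product G a m n"
abbreviation cpow where "cpow l \<equiv> ordered_product G c l r"

lemma cpow_in_Z: "cpow l \<in> Z"
  using Z_range by blast

lemma c_closed: "c \<in> {..<r} \<rightarrow> carrier G"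
  using c_in_Z Z_carrier by blast

lemma cpow_closed [simp]: "cpow l \<in> carrier G"
  using c_closed by simp

lemma apow_closed [simp]: "apow l \<in> carrier G"
  using a_closed by simp

lemma apow_cancel: "apow m \<otimes> cpow l = apow m \<otimes> cpow k \<longleftrightarrow> cpow l = cpow k"
  by (intro Units_l_cancel) simp_all

lemma cpow_commute: "g \<in> carrier G \<Longrightarrow> cpow l \<otimes> g = g \<otimes> cpow l"
  using derived_central cpow_in_Z by blast

lemma ordered_product_central_add:
  assumes "x \<in> {..<s} \<rightarrow> Z"
  shows "ordered_product G x (\<lambda>k. l k + m k) s = ordered_product G x l s \<otimes> ordered_product G x m s"
  using assms
proof (induction s)
  case (Suc s)
  define g h where "g = ordered_product G x l s" and "h = ordered_product G x m s"
  have x: "x s \<in> Z" "x s \<in> carrier G" and xs: "x \<in> {..<s} \<rightarrow> Z" "x \<in> {..<s} \<rightarrow> carrier G"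
    using Suc.prems Z_carrier by (auto simp: Pi_iff)
  have gh: "g \<in> carrier G" "h \<in> carrier G"
    using xs by (simp_all add: g_def h_def)
  have "x s [^] l s \<otimes> h = h \<otimes> x s [^] l s"
    using subgroup_int_pow_closed[OF subgroup_Z x(1)] gh by (intro derived_central)
  then have "g \<otimes> h \<otimes> (x s [^] l s \<otimes> x s [^] m s) = (g \<otimes> x s [^] l s) \<otimes> (h \<otimes> x s [^] m s)"
    using x gh by (simp add: m_assoc[symmetric]) (simp add: m_assoc)
  then show ?case
    using Suc.IH[OF xs(1)] x by (simp add: int_pow_mult g_def h_def)
qed simp

lemma cpow_add: "cpow (\<lambda>k. l k + m k) = cpow l \<otimes> cpow m"
  by (rule ordered_product_central_add[OF c_in_Z])

lemma cpow_zero: "cpow (\<lambda>k. 0) = \<one>"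
  by (simp add: c_eq_one)

lemma cpow_eq_iff: "cpow l = cpow m \<longleftrightarrow> (\<forall>k<r. int (e k) dvd l k - m k)"
proof -
  have "cpow l = cpow m \<otimes> cpow (\<lambda>k. l k - m k)"
    using cpow_add[of m "\<lambda>k. l k - m k"] by simp
  then have "cpow l = cpow m \<longleftrightarrow> cpow (\<lambda>k. l k - m k) = \<one>"
    using l_cancel_one[OF cpow_closed cpow_closed] by simp
  then show ?thesis by (simp add: c_eq_one)
qed

lemma cpow_int_pow: "cpow (\<lambda>k. t * l k) = cpow l [^] (t :: int)"
proof -
  let ?Z = "G\<lparr>carrier := Z\<rparr>"
  interpret Z: comm_group ?Z by (rule comm_group_Z)
  have c: "c \<in> {..<r} \<rightarrow> carrier ?Z" using c_in_Z by simp
  have eq: "cpow l = Z.combination {..<r} c l" for l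
    using Z.ordered_product_eq_combination[OF c] ordered_product_subgroup[OF subgroup_Z c_in_Z] by simp
  have "cpow (\<lambda>k. t * l k) = Z.combination {..<r} c l [^]\<^bsub>?Z\<^esub> t"
    unfolding eq by (rule Z.combination_scale[OF finite_lessThan c])
  also have "\<dots> = cpow l [^] t"
    unfolding eq[symmetric] by (rule int_pow_consistent[OF subgroup_Z cpow_in_Z, symmetric])
  finally show ?thesis .
qed

text \<open>\<open>a j\<close> travels left to its own power. Passing \<open>a i [^] m i\<close>
  with \<open>i > j\<close> produces \<open>commutator (a i) (a j) [^] m i\<close>, so
  \<open>\<beta> i\<close> can be taken as the exponent vector of that commutator, and as zero for
  \<open>i \<le> j\<close>. It is independent of \<open>m\<close>, which makes the correction
  linear.\<close>

lemma ordered_product_mult_generator: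
  assumes "j < n"
  obtains \<beta> :: "nat \<Rightarrow> nat \<Rightarrow> int" where
    "\<And>m. apow m \<otimes> a j = apow (m(j := m j + 1)) \<otimes> cpow (\<lambda>k. \<Sum>i<n. m i * \<beta> i k)"
proof -
  have aj: "a j \<in> carrier G" using a_closed assms by auto
  have "\<exists>\<beta> :: nat \<Rightarrow> nat \<Rightarrow> int. \<forall>m. ordered_product G a m s \<otimes> a j =
      ordered_product G a (m(j := m j + 1)) s \<otimes> cpow (\<lambda>k. \<Sum>i<s. m i * \<beta> i k)"
    if "j < s" "s \<le> n" for s
    using that
  proof (induction s)
    case (Suc s)
    have as: "a s \<in> carrier G" and a_s: "a \<in> {..<s} \<rightarrow> carrier G"
      using a_closed Suc.prems by auto
    have closed: "ordered_product G a m s \<in> carrier G" for m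
      using a_s by simp
    show ?case
    proof (cases "j = s")
      \<comment> \<open>Here \<open>a j\<close> already stands next to its own power, so no
        commutator arises and the coefficients start at \<open>0\<close>.\<close>
      case True
      have "ordered_product G a (m(s := t)) s = ordered_product G a m s" for m t
        by (intro ordered_product_cong) auto
      then have "ordered_product G a m (Suc s) \<otimes> a j =
          ordered_product G a (m(j := m j + 1)) (Suc s) \<otimes> cpow (\<lambda>k. \<Sum>i<Suc s. m i * 0)" for m
        using True as closed by (simp add: cpow_zero int_pow_mult m_assoc)
      then show ?thesis by (intro exI[of _ "\<lambda>_ _. 0"]) blast
    next
      case False
      then have "j < s" "s \<le> n"
        using Suc.prems by auto
      from Suc.IH[OF this]
      obtain \<beta> :: "nat \<Rightarrow> nat \<Rightarrow> int" where \<beta>: "\<forall>m. ordered_product G a m s \<otimes> a j =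
          ordered_product G a (m(j := m j + 1)) s \<otimes> cpow (\<lambda>k. \<Sum>i<s. m i * \<beta> i k)"
        by blast
      obtain \<gamma> where \<gamma>: "commutator (a s) (a j) = cpow \<gamma>"
        using commutator_in_Z[OF as aj] Z_range by auto
      define \<beta>' where "\<beta>' = \<beta>(s := \<gamma>)"
      have "ordered_product G a m (Suc s) \<otimes> a j =
          ordered_product G a (m(j := m j + 1)) (Suc s) \<otimes> cpow (\<lambda>k. \<Sum>i<Suc s. m i * \<beta>' i k)" for m
      proof -
        let ?P = "ordered_product G a m s" and ?Q = "ordered_product G a (m(j := m j + 1)) s"
        let ?x = "a s [^] m s" and ?S = "\<lambda>k. \<Sum>i<s. m i * \<beta> i k"
        have x: "?x \<in> carrier G" using as by simp
        have "?x \<otimes> a j = a j \<otimes> ?x \<otimes> cpow (\<lambda>k. m s * \<gamma> k)"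
          using mult_swap_commutator[OF x aj] commutator_int_pow[OF as aj] \<gamma> by (simp add: cpow_int_pow)
        then have "?P \<otimes> ?x \<otimes> a j = (?P \<otimes> a j) \<otimes> ?x \<otimes> cpow (\<lambda>k. m s * \<gamma> k)"
          using closed x aj by (simp add: m_assoc)
        also have "\<dots> = ?Q \<otimes> (cpow ?S \<otimes> ?x) \<otimes> cpow (\<lambda>k. m s * \<gamma> k)"
          using closed x by (simp add: \<beta>[rule_format] m_assoc)
        also have "\<dots> = ?Q \<otimes> ?x \<otimes> (cpow ?S \<otimes> cpow (\<lambda>k. m s * \<gamma> k))"
          using closed x by (simp add: cpow_commute[OF x] m_assoc)
        also have "cpow ?S \<otimes> cpow (\<lambda>k. m s * \<gamma> k) = cpow (\<lambda>k. \<Sum>i<Suc s. m i * \<beta>' i k)"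
          unfolding cpow_add[symmetric] by (simp add: \<beta>'_def)
        moreover have "(m(j := m j + 1)) s = m s"
          using False by simp
        ultimately show ?thesis
          unfolding ordered_product.simps by (simp only:)
      qed
      then show ?thesis by blast
    qed
  qed simp
  then obtain \<beta> :: "nat \<Rightarrow> nat \<Rightarrow> int" where "\<forall>m. apow m \<otimes> a j =
      apow (m(j := m j + 1)) \<otimes> cpow (\<lambda>k. \<Sum>i<n. m i * \<beta> i k)"
    using assms by blast
  then show thesis using that by blast
qed

text \<open>The surplus \<open>a j [^] t\<close> is central and can be moved to the end of the word;
  this is the carry.\<close>

lemma ordered_product_split_central:
  assumes "j < n" "a j [^] (t :: int) \<in> Z"
  shows "apow (m(j := m j + t)) = apow m \<otimes> a j [^] t"
proof -
  have "ordered_product G a (m(j := m j + t)) s = ordered_product G a m s \<otimes> (if j < s then a j [^] t else \<one>)"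
    if "s \<le> n" for s
    using that
  proof (induction s)
    case (Suc s)
    have as: "a s \<in> carrier G" "a j \<in> carrier G" and a_s: "a \<in> {..<s} \<rightarrow> carrier G"
      using a_closed Suc.prems assms(1) by auto
    have closed: "ordered_product G a m s \<in> carrier G"
      using a_s by simp
    have "a j [^] t \<otimes> a s [^] m s = a s [^] m s \<otimes> a j [^] t"
      using assms(2) as by (intro derived_central) auto
    then show ?case
      using Suc as closed by (auto simp: less_Suc_eq int_pow_mult m_assoc)
  qed simp
  then show ?thesis using assms(1) by simp
qed

abbreviation bounds where "bounds \<equiv> \<lambda>i. if i < n then d i else e (i - n)"

definition normal_form :: "(nat \<Rightarrow> int) \<Rightarrow> 'a" where
  "normal_form v = apow v \<otimes> cpow (\<lambda>k. v (n + k))"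

text \<open>Modulo \<open>Z\<close> the central factors disappear, so equal elements have congruent
  exponents in the abelianization.\<close>

lemma apow_eq_imp_dvd:
  assumes "apow u \<otimes> cpow l = apow v \<otimes> cpow m" "i < n"
  shows "int (d i) dvd u i - v i"
proof -
  have "apow u = apow v \<otimes> (cpow m \<otimes> inv (cpow l))"
    using assms(1) by (metis apow_closed cpow_closed inv_closed inv_solve_right m_assoc m_closed)
  moreover have "cpow m \<otimes> inv (cpow l) \<in> Z"
    using cpow_in_Z subgroup_Z by (simp add: subgroup.m_closed subgroup.m_inv_closed)
  ultimately show ?thesis
    using a_cong[of u v] assms(2) by blast
qed

lemma box_cong_left:
  assumes "u \<in> mixed_box (n + r) bounds" "v \<in> mixed_box (n + r) bounds"
    "i < n" "int (d i) dvd u i - v i"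
  shows "u i = v i"
  using mixed_box_eqI[OF assms(1,2), of i] assms(3,4) by simp

lemma box_cong_right:
  assumes "u \<in> mixed_box (n + r) bounds" "v \<in> mixed_box (n + r) bounds"
    "k < r" "int (e k) dvd u (n + k) - v (n + k)"
  shows "u (n + k) = v (n + k)"
  using mixed_box_eqI[OF assms(1,2), of "n + k"] assms(3,4) by simp

lemma apow_cong: "(\<And>i. i < n \<Longrightarrow> m i = k i) \<Longrightarrow> apow m = apow k"
  by (intro ordered_product_cong) auto

text \<open>Injectivity: the abelianization fixes the first block, which then cancels and leaves an
  equation in \<open>Z\<close>. Surjectivity: reducing the first block costs a central factor,
  merged into the second block before that is reduced.\<close>

lemma bij_betw_normal_form: "bij_betw normal_form (mixed_box (n + r) bounds) (carrier G)"
  unfolding bij_betw_def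
proof
  show "inj_on normal_form (mixed_box (n + r) bounds)"
  proof (rule inj_onI)
    fix u v assume uv: "u \<in> mixed_box (n + r) bounds" "v \<in> mixed_box (n + r) bounds"
      and eq: "normal_form u = normal_form v"
    have left: "u i = v i" if "i < n" for i
      using box_cong_left[OF uv that] apow_eq_imp_dvd[OF eq[unfolded normal_form_def] that] .
    then have "apow u = apow v"
      by (rule apow_cong)
    then have "cpow (\<lambda>k. u (n + k)) = cpow (\<lambda>k. v (n + k))"
      using eq unfolding normal_form_def by (simp only: apow_cancel)
    then have right: "u (n + k) = v (n + k)" if "k < r" for k
      using box_cong_right[OF uv that] that unfolding cpow_eq_iff by simp
    show "u = v"
    proof
      fix i
      consider "i < n" | k where "i = n + k" "k < r" | "i \<ge> n + r"
        by (metis add_diff_inverse_nat nat_add_left_cancel_less not_less)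
      then show "u i = v i"
        using left right uv by cases (auto simp: mixed_box_def)
    qed
  qed
next
  show "normal_form ` mixed_box (n + r) bounds = carrier G"
  proof (intro equalityI subsetI)
    fix g assume "g \<in> carrier G"
    then obtain m z where z: "z \<in> Z" "g = apow m \<otimes> z"
      using a_surj by blast
    \<comment> \<open>Since \<open>x mod 0 = x\<close>, exponents of generators of infinite order
      stay as they are.\<close>
    define m' where "m' i = m i mod int (d i)" for i
    have "\<forall>i<n. int (d i) dvd m i - m' i"
      by (simp add: m'_def dvd_minus_mod)
    then obtain z' where z': "z' \<in> Z" "apow m = apow m' \<otimes> z'"
      using a_cong by blast
    have "z' \<otimes> z \<in> Z"
      using z(1) z'(1) subgroup.m_closed[OF subgroup_Z] by blast
    then obtain l where l: "z' \<otimes> z = cpow l"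
      using Z_range by auto
    define l' where "l' k = l k mod int (e k)" for k
    have l': "cpow l = cpow l'"
      unfolding cpow_eq_iff by (simp add: l'_def dvd_minus_mod)
    define v where "v i = (if i < n then m' i else if i < n + r then l' (i - n) else 0)" for i
    have "v \<in> mixed_box (n + r) bounds"
      by (auto simp: mixed_box_def v_def m'_def l'_def)
    moreover have "apow v = apow m'"
      by (intro apow_cong) (simp add: v_def)
    moreover have "cpow (\<lambda>k. v (n + k)) = cpow l'"
      by (intro ordered_product_cong) (auto simp: v_def)
    moreover have "g = apow m' \<otimes> cpow l'"
      using z z' l l' Z_carrier by (simp add: m_assoc)
    ultimately show "g \<in> normal_form ` mixed_box (n + r) bounds"
      by (intro image_eqI[of _ _ v]) (simp_all add: normal_form_def)
  qed (auto simp: normal_form_def)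
qed

lemma finite_generating_set_normal_form: "finite_generating_set G (a ` {..<n} \<union> c ` {..<r})"
proof -
  let ?X = "a ` {..<n} \<union> c ` {..<r}"
  have X: "?X \<subseteq> carrier G"
    using a_closed c_closed by auto
  have H: "subgroup (generate G ?X) G"
    using X by (rule generate_is_subgroup)
  have op: "ordered_product G x m s \<in> generate G ?X" if "\<And>i. i < s \<Longrightarrow> x i \<in> ?X" for x m s
    using that
  proof (induction s)
    case 0
    then show ?case by (simp add: generate.one)
  next
    case (Suc s)
    have "x s \<in> generate G ?X"
      by (rule generate.incl[OF Suc.prems]) simp
    then have "x s [^] m s \<in> generate G ?X"
      by (rule subgroup_int_pow_closed[OF H])
    moreover have "ordered_product G x m s \<in> generate G ?X"
      using Suc by simp
    ultimately show ?case
      by (simp add: generate.eng)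
  qed
  have "g \<in> generate G ?X" if g: "g \<in> carrier G" for g
  proof -
    obtain m z where z: "z \<in> Z" "g = apow m \<otimes> z"
      using a_surj g by blast
    moreover obtain l where "z = cpow l"
      using z(1) Z_range by auto
    ultimately show ?thesis
      by (simp only:) (intro generate.eng op; simp)
  qed
  then show ?thesis
    using X subgroup.subset[OF H] unfolding finite_generating_set_def by auto
qed

text \<open>Multiplication by a fixed central element shifts the second block by a constant vector.
  Within the box, congruence of the first blocks already means equality.\<close>

lemma edge_relation_central:
  assumes "x \<in> Z"
  shows "\<exists>Q. recognizable_relation Q \<and> (\<forall>u \<in> mixed_box (n + r) bounds.
    \<forall>v \<in> mixed_box (n + r) bounds. normal_form u \<otimes> x = normal_form v \<longleftrightarrow> Q u v)"
proof -
  obtain l where l: "x = cpow l" using assms Z_range by auto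
  define Q where "Q = (\<lambda>u v :: nat \<Rightarrow> int.
    (\<forall>i<n. int (d i) dvd (\<Sum>i<0. u i * 0) + u i + 0 - v i) \<and>
    (\<forall>k<r. int (e k) dvd (\<Sum>i<0. u i * 0) + u (n + k) + l k - v (n + k)))"
  have "recognizable_relation Q"
    unfolding Q_def by (intro recognizable_relation_conj recognizable_relation_all recognizable_relation_dvd)
  moreover have "normal_form u \<otimes> x = normal_form v \<longleftrightarrow> Q u v"
    if uv: "u \<in> mixed_box (n + r) bounds" "v \<in> mixed_box (n + r) bounds" for u v
  proof -
    have eq: "normal_form u \<otimes> x = apow u \<otimes> cpow (\<lambda>k. u (n + k) + l k)"
      unfolding normal_form_def l cpow_add by (simp add: m_assoc)
    have left: "apow u = apow v" if "\<forall>i<n. int (d i) dvd u i - v i"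
      using that box_cong_left[OF uv] by (intro apow_cong) blast
    show ?thesis
    proof (cases "\<forall>i<n. int (d i) dvd u i - v i")
      case True
      have "normal_form u \<otimes> x = normal_form v \<longleftrightarrow>
          cpow (\<lambda>k. u (n + k) + l k) = cpow (\<lambda>k. v (n + k))"
        unfolding eq unfolding left[OF True] normal_form_def by (rule apow_cancel)
      then show ?thesis
        using True unfolding cpow_eq_iff Q_def by simp
    next
      case False
      have "normal_form u \<otimes> x \<noteq> normal_form v"
      proof
        assume "normal_form u \<otimes> x = normal_form v"
        then have "apow u \<otimes> cpow (\<lambda>k. u (n + k) + l k) = apow v \<otimes> cpow (\<lambda>k. v (n + k))"
          unfolding eq unfolding normal_form_def .
        then have "\<forall>i<n. int (d i) dvd u i - v i"
          by (intro allI impI apow_eq_imp_dvd)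
        then show False using False by contradiction
      qed
      then show ?thesis
        using False by (simp add: Q_def)
    qed
  qed
  ultimately show ?thesis by blast
qed

text \<open>If the exponent of \<open>a j\<close> wraps around from \<open>d j - 1\<close> to \<open>0\<close>, the central element
  \<open>a j [^] d j\<close> is carried over into the exponents of \<open>c\<close>.\<close>

lemma edge_relation_generator:
  assumes j: "j < n"
  shows "\<exists>Q. recognizable_relation Q \<and> (\<forall>u \<in> mixed_box (n + r) bounds.
    \<forall>v \<in> mixed_box (n + r) bounds. normal_form u \<otimes> a j = normal_form v \<longleftrightarrow> Q u v)"
proof -
  have aj: "a j \<in> carrier G" using a_closed j by auto
  obtain \<beta> :: "nat \<Rightarrow> nat \<Rightarrow> int" where \<beta>:
    "\<And>m. apow m \<otimes> a j = apow (m(j := m j + 1)) \<otimes> cpow (\<lambda>k. \<Sum>i<n. m i * \<beta> i k)"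
    using ordered_product_mult_generator[OF j] by blast
  have ajZ: "a j [^] int (d j) \<in> Z"
  proof -
    \<comment> \<open>The exponent vector with \<open>d j\<close> at \<open>j\<close> is congruent
      to zero, so its product lies in \<open>Z\<close>. Zero is written as a conditional to fit
      \<open>ordered_product_single\<close>.\<close>
    have "\<exists>z\<in>Z. apow (\<lambda>i. if i = j then int (d j) else 0) = apow (\<lambda>i. if i = j then 0 else 0) \<otimes> z"
      unfolding a_cong by simp
    then show ?thesis
      using Z_carrier j aj unfolding ordered_product_single[OF a_closed] by auto
  qed
  then obtain \<phi> where \<phi>: "a j [^] int (d j) = cpow \<phi>"
    using Z_range by auto
  \<comment> \<open>\<open>L\<close> is the edge condition in the abelianization, \<open>S b\<close>
    the one in \<open>Z\<close> with carry vector \<open>b\<close>, and \<open>W\<close>, an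
    equation because its modulus is \<open>0\<close>, says that no wrap-around occurs.\<close>
  define L where "L = (\<lambda>u v :: nat \<Rightarrow> int.
    \<forall>i<n. int (d i) dvd (\<Sum>i<0. u i * 0) + u i + of_bool (i = j) - v i)"
  define S where "S b = (\<lambda>u v :: nat \<Rightarrow> int.
    \<forall>k<r. int (e k) dvd (\<Sum>i<n. u i * \<beta> i k) + u (n + k) + b k - v (n + k))" for b
  define W where "W = (\<lambda>u v :: nat \<Rightarrow> int. 0 dvd (\<Sum>i<0. u i * 0) + u j + 1 - v j)"
  define Q where "Q = (\<lambda>u v. L u v \<and> (W u v \<longrightarrow> S (\<lambda>_. 0) u v) \<and> (\<not> W u v \<longrightarrow> S \<phi> u v))"
  have "recognizable_relation Q"
    unfolding Q_def L_def S_def W_def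
    by (intro recognizable_relation_conj recognizable_relation_imp recognizable_relation_not
        recognizable_relation_all recognizable_relation_dvd)
  moreover have "normal_form u \<otimes> a j = normal_form v \<longleftrightarrow> Q u v"
    if uv: "u \<in> mixed_box (n + r) bounds" "v \<in> mixed_box (n + r) bounds" for u v
  proof -
    let ?u = "u(j := u j + 1)"
    let ?s = "\<lambda>k. (\<Sum>i<n. u i * \<beta> i k) + u (n + k)"
    have eq: "normal_form u \<otimes> a j = apow ?u \<otimes> cpow ?s"
    proof -
      have "normal_form u \<otimes> a j = (apow u \<otimes> a j) \<otimes> cpow (\<lambda>k. u (n + k))"
        unfolding normal_form_def using aj by (simp add: m_assoc cpow_commute[OF aj])
      then show ?thesis
        unfolding \<beta> cpow_add by (simp add: m_assoc)
    qed
    have L_iff: "L u v \<longleftrightarrow> (\<forall>i<n. int (d i) dvd ?u i - v i)"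
      unfolding L_def by (intro all_cong) (simp add: fun_upd_def)
    have S_iff: "S b u v \<longleftrightarrow> apow v \<otimes> cpow (\<lambda>k. ?s k + b k) = normal_form v" for b
    proof -
      have "apow v \<otimes> cpow (\<lambda>k. ?s k + b k) = normal_form v \<longleftrightarrow>
          cpow (\<lambda>k. ?s k + b k) = cpow (\<lambda>k. v (n + k))"
        unfolding normal_form_def by (rule apow_cancel)
      then show ?thesis
        unfolding cpow_eq_iff S_def by (simp only:)
    qed
    show ?thesis
    proof (cases "L u v")
      case True
      have other: "?u i = v i" if "i < n" "i \<noteq> j" for i
        using box_cong_left[OF uv that(1)] True that unfolding L_iff by auto
      show ?thesis
      proof (cases "W u v")
        case W: True
        then have "apow ?u = apow v"
          using other by (intro apow_cong) (auto simp: W_def)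
        then show ?thesis
          using True W S_iff[of "\<lambda>_. 0"] by (simp add: Q_def eq)
      next
        case W: False
        have "int (d j) dvd u j + 1 - v j"
          using True j unfolding L_iff by force
        then obtain t where t: "u j + 1 - v j = int (d j) * t" by (auto simp: dvd_def)
        \<comment> \<open>Failure of \<open>W\<close> rules out \<open>t = 0\<close>, hence also
          \<open>d j = 0\<close>. Both exponents lie in \<open>[0, d j)\<close>, so
          \<open>u j + 1 - v j\<close> is above \<open>- d j\<close> and at most \<open>d j\<close>,
          which leaves only \<open>t = 1\<close>.\<close>
        have d: "d j > 0" and ne: "t \<noteq> 0"
          using W t by (auto simp: W_def intro: gr0I)
        have "0 \<le> u j \<and> u j < int (d j)" "0 \<le> v j \<and> v j < int (d j)"
          using mixed_boxD[OF uv(1), of j] mixed_boxD[OF uv(2), of j] j d by simp_all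
        then have "u j + 1 - v j \<le> int (d j)" "u j + 1 - v j > - int (d j)"
          by linarith+
        then have "int (d j) * t \<le> int (d j) * 1" "int (d j) * (-1) < int (d j) * t"
          using t by simp_all
        then have "t \<le> 1" "-1 < t"
          using d by (simp_all only: mult_le_cancel_left_pos mult_less_cancel_left_pos of_nat_0_less_iff)
        then have "t = 1"
          using ne by linarith
        then have "u j + 1 = v j + int (d j)"
          using t by simp
        then have "apow ?u = apow (v(j := v j + int (d j)))"
          using other by (intro apow_cong) auto
        also have "\<dots> = apow v \<otimes> cpow \<phi>"
          unfolding ordered_product_split_central[OF j ajZ] \<phi> ..
        finally have "normal_form u \<otimes> a j = apow v \<otimes> cpow (\<lambda>k. ?s k + \<phi> k)"
          unfolding eq cpow_add[of ?s \<phi>] by (simp add: m_assoc cpow_commute[OF cpow_closed])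
        then show ?thesis
          using True W S_iff[of \<phi>] by (simp add: Q_def)
      qed
    next
      case False
      have "normal_form u \<otimes> a j \<noteq> normal_form v"
      proof
        assume "normal_form u \<otimes> a j = normal_form v"
        then have "apow ?u \<otimes> cpow ?s = apow v \<otimes> cpow (\<lambda>k. v (n + k))"
          unfolding eq unfolding normal_form_def .
        then have "L u v"
          unfolding L_iff by (intro allI impI apow_eq_imp_dvd)
        then show False using False by contradiction
      qed
      then show ?thesis
        using False by (simp add: Q_def)
    qed
  qed
  ultimately show ?thesis by blast
qed

lemma graph_automatic_normal_form: "graph_automatic G"
proof (rule graph_automatic_mixed_box[OF finite_generating_set_normal_form is_group bij_betw_normal_form])
  fix x assume "x \<in> a ` {..<n} \<union> c ` {..<r}"
  then consider j where "j < n" "x = a j" | "x \<in> Z"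
    using c_in_Z by auto
  then show "\<exists>Q. recognizable_relation Q \<and> (\<forall>u \<in> mixed_box (n + r) bounds.
      \<forall>v \<in> mixed_box (n + r) bounds. normal_form u \<otimes> x = normal_form v \<longleftrightarrow> Q u v)"
  proof cases
    case 1
    show ?thesis
      unfolding 1(2) by (rule edge_relation_generator[OF 1(1)])
  next
    case 2
    then show ?thesis
      by (rule edge_relation_central)
  qed
qed

end

section \<open>From the nilpotency class to a central derived subgroup\<close>

lemma lower_central_series_Suc_0: "lower_central_series G (Suc 0) = derived G (carrier G)"
proof -
  have "{h \<otimes>\<^bsub>G\<^esub> k \<otimes>\<^bsub>G\<^esub> inv\<^bsub>G\<^esub> h \<otimes>\<^bsub>G\<^esub> inv\<^bsub>G\<^esub> k | h k. h \<in> carrier G \<and> k \<in> carrier G} = derived_set G (carrier G)"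
    by auto
  then show ?thesis by (simp add: commutator_subgroup_def derived_def)
qed

lemma lower_central_series_trivial_Suc:
  assumes "group G" "lower_central_series G k = {\<one>\<^bsub>G\<^esub>}"
  shows "lower_central_series G (Suc k) = {\<one>\<^bsub>G\<^esub>}"
proof -
  interpret group G by fact
  have "{h \<otimes>\<^bsub>G\<^esub> k \<otimes>\<^bsub>G\<^esub> inv\<^bsub>G\<^esub> h \<otimes>\<^bsub>G\<^esub> inv\<^bsub>G\<^esub> k | h k. h \<in> {\<one>\<^bsub>G\<^esub>} \<and> k \<in> carrier G} = {\<one>\<^bsub>G\<^esub>}"
    by (auto intro!: exI[of _ "\<one>\<^bsub>G\<^esub>"])
  then show ?thesis
    using assms(2) generate_one by (simp add: commutator_subgroup_def)
qed

text \<open>The class is a least index and may be below two, so triviality is first propagated up to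
  index two. That term consists of commutators of \<open>Z\<close> with the group, and its vanishing
  is centrality of \<open>Z\<close>.\<close>

lemma class_two_groupI:
  assumes "nilpotent_group G" "nilpotency_class G \<le> 2"
  shows "class_two_group G"
proof -
  interpret group G using assms(1) by (simp add: nilpotent_group_def)
  have "lower_central_series G (nilpotency_class G) = {\<one>\<^bsub>G\<^esub>}"
  proof -
    obtain k where "lower_central_series G k = {\<one>\<^bsub>G\<^esub>}"
      using assms(1) unfolding nilpotent_group_def by blast
    then show ?thesis
      unfolding nilpotency_class_def by (rule LeastI[where P = "\<lambda>n. lower_central_series G n = {\<one>\<^bsub>G\<^esub>}"])
  qed
  moreover have "lower_central_series G (k + t) = {\<one>\<^bsub>G\<^esub>}" if "lower_central_series G k = {\<one>\<^bsub>G\<^esub>}" for k t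
    using that
  proof (induction t)
    case (Suc t)
    then show ?case
      unfolding add_Suc_right by (intro lower_central_series_trivial_Suc is_group)
  qed simp
  moreover obtain t where "Suc (Suc 0) = nilpotency_class G + t"
    using assms(2) le_Suc_ex unfolding numeral_2_eq_2 by blast
  ultimately have "lower_central_series G (Suc (Suc 0)) = {\<one>\<^bsub>G\<^esub>}"
    by (simp only:)
  then have trivial: "commutator_subgroup G (derived G (carrier G)) (carrier G) = {\<one>\<^bsub>G\<^esub>}"
    unfolding lower_central_series.simps(2)[of G "Suc 0"] lower_central_series_Suc_0 .
  show ?thesis
  proof
    fix z g assume z: "z \<in> derived G (carrier G)" and g: "g \<in> carrier G"
    have zc: "z \<in> carrier G"
      using z derived_in_carrier[of "carrier G"] by blast
    have "z \<otimes>\<^bsub>G\<^esub> g \<otimes>\<^bsub>G\<^esub> inv\<^bsub>G\<^esub> z \<otimes>\<^bsub>G\<^esub> inv\<^bsub>G\<^esub> g \<in> commutator_subgroup G (derived G (carrier G)) (carrier G)"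
      unfolding commutator_subgroup_def using z g by (intro generate.incl) blast
    then have "z \<otimes>\<^bsub>G\<^esub> g \<otimes>\<^bsub>G\<^esub> inv\<^bsub>G\<^esub> z \<otimes>\<^bsub>G\<^esub> inv\<^bsub>G\<^esub> g = \<one>\<^bsub>G\<^esub>"
      using trivial by simp
    then have "\<one>\<^bsub>G\<^esub> = (z \<otimes>\<^bsub>G\<^esub> g) \<otimes>\<^bsub>G\<^esub> inv\<^bsub>G\<^esub> (g \<otimes>\<^bsub>G\<^esub> z)"
      using zc g by (simp add: inv_mult_group m_assoc)
    then show "z \<otimes>\<^bsub>G\<^esub> g = g \<otimes>\<^bsub>G\<^esub> z"
      using zc g inv_solve_right[of "\<one>\<^bsub>G\<^esub>" "z \<otimes>\<^bsub>G\<^esub> g" "g \<otimes>\<^bsub>G\<^esub> z"] by simp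
  qed
qed

theorem theorem12p4:
  fixes G :: "('g, 'm) monoid_scheme"
  assumes "finitely_generated_group G"
    and "nilpotent_group G"
    and "nilpotency_class G \<le> 2"
  shows "graph_automatic G"
proof -
  interpret class_two_group G
    using assms(2,3) by (rule class_two_groupI)
  obtain X where X: "finite_generating_set G X"
    using assms(1) by (auto simp: finitely_generated_group_def)
  obtain c e r where c: "c \<in> {..<r} \<rightarrow> Z"
    "Z = range (\<lambda>l. ordered_product G c l r)"
    "\<And>l. ordered_product G c l r = \<one>\<^bsub>G\<^esub> \<longleftrightarrow> (\<forall>k<r. int (e k) dvd l k)"
    by (rule obtain_derived_generators[OF X]) (rule that; assumption)
  obtain a d n where a: "a \<in> {..<n} \<rightarrow> carrier G"
    "\<And>g. g \<in> carrier G \<Longrightarrow> \<exists>m. \<exists>z\<in>Z. g = ordered_product G a m n \<otimes>\<^bsub>G\<^esub> z"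
    "\<And>m k. (\<exists>z\<in>Z. ordered_product G a m n = ordered_product G a k n \<otimes>\<^bsub>G\<^esub> z) \<longleftrightarrow>
       (\<forall>i<n. int (d i) dvd m i - k i)"
    by (rule obtain_abelianization_generators[OF X]) (rule that; assumption)
  interpret class_two_normal_form G a d n c e r
    by unfold_locales (fact a c)+
  show ?thesis
    by (rule graph_automatic_normal_form)
qed

end
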